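(* Let $\mathbb{H}=(\mathcal X,P,\{\mathcal Q_n\}_{n\in\mathbb N})$ consist of a finite set $\mathcal X$, a distribution $P\in\mathcal P(\mathcal X)$ and sets $\mathcal Q_n\subseteq\mathcal P(\mathcal X^n)$, and write $\mathcal Q=\mathcal Q_1$. Let $0\le a<1$ and suppose that Axioms 2, 3, 4 and 5 (stated in the context) are satisfied on $J=(a,1]$. Then for every $R>R_a$, $$\mathrm e_R(\mathbb H)=\sup_{s\in(a,1)}\Big\{\frac{1-s}{s}\big(D_s(P\|\mathcal Q)-R\big)\Big\}.$$
   Context: $\mathcal P(\mathcal X)$ is the set of probability mass functions (distributions) on the finite set $\mathcal X$; $P^{\times n}(x^n)=\prod_{i=1}^nP(x_i)$. $\log$ and $\exp$ are inverse to each other, in any fixed base; $-\log 0=+\infty$. Hypothesis testing. For a test $T:\mathcal X^n\to[0,1]$ put $\alpha(T;P^{\times n})=\sum_{x^n}P^{\times n}(x^n)(1-T(x^n))$ and $\beta(T;\mathcal Q_n)=\sup_{Q\in\mathcal Q_n}\sum_{x^n}Q(x^n)T(x^n)$. Let $\hat\alpha(\mu;P^{\times n}\|\mathcal Q_n)=\min_T\{\alpha(T;P^{\times n}):\beta(T;\mathcal Q_n)\le\mu\}$. The error exponent is, for $R>0$, $\mathrm e_R(\mathbb H)=\liminf_{n\to\infty}-\frac1n\log\hat\alpha(\exp(-nR);P^{\times n}\|\mathcal Q_n)\in[0,+\infty]$. Rényi divergence. For $s\in(0,1)\cup(1,\infty)$, $g_s(P\|Q)=\sum_{x:P(x)>0}P(x)^sQ(x)^{1-s}$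 (equal to $+\infty$ if $s>1$ and $Q(x)=0<P(x)$ for some $x$), $D_s(P\|Q)=\frac{1}{s-1}\log g_s(P\|Q)$, and $D_1(P\|Q)=D(P\|Q)=\sum_xP(x)(\log P(x)-\log Q(x))$. For a set, $D_s(P\|\mathcal Q)=\inf_{Q\in\mathcal Q}D_s(P\|Q)$. Critical rate. $\phi(s)=(s-1)D_s(P\|\mathcal Q)$ and $R_a=\lim_{s\searrow a}\big(s\phi'(s)-\phi(s)\big)$. Permutations. $S_n$ acts on $\mathcal P(\mathcal X^n)$ by $(P^nW^n[\pi])(x_1,\dots,x_n)=P^n(x_{\pi(1)},\dots,x_{\pi(n)})$; $\mathcal P^{\rm sym}(\mathcal X^n)$ is the set of invariant distributions and $\mathcal Q_n^{\rm sym}=\mathcal Q_n\cap\mathcal P^{\rm sym}(\mathcal X^n)$. Axioms on an interval $J$ containing $1$: Axiom 2: $Q^{\times n}\in\mathcal Q_n$ for every $Q\in\mathcal Q$ and $n\in\mathbb N$. Axiom 3: $D_s(P^{\times n}\|\mathcal Q_n)\ge nD_s(P\|\mathcal Q)$ for all $s\in J$, $n\in\mathbb N$. Axiom 4: there are $U^n\in\mathcal P^{\rm sym}(\mathcal X^n)$, $n\in\mathbb N$, and a polynomial $v(n)$ such that for all $n$: $Q(x^n)\le v(n)U^n(x^n)$ for all $Q\in\mathcal Q_n^{\rm sym}$ and $x^n\in\mathcal X^n$; and $D_s(P^{\times n}\|U^n)\ge D_s(P^{\times n}\|\mathcal Q_n)$ for all $s\in J$. Moreover, $P^n\in\mathcal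 Q_n$ implies $\frac1{n!}\sum_{\pi\in S_n}P^nW^n[\pi]\in\mathcal Q_n^{\rm sym}$. Axiom 5: there is a compact convex set $\Theta$ in a finite-dimensional vector space and a $C^2$ map $\theta\mapsto Q_\theta$ with $\mathcal Q=\{Q_\theta:\theta\in\Theta\}$ such that: for all $s\in J$ the minimizer $\hat\theta^s=\arg\min_{\theta\in\Theta}D_s(P\|Q_\theta)$ is unique and lies in the relative interior of $\Theta$; the map $\theta\mapsto g_s(P\|Q_\theta)$ has negative definite Hessian at $\hat\theta^s$ for all $s\in J$ with $s<1$ and positive definite Hessian at $\hat\theta^s$ for all $s\in J$ with $s>1$; and $\theta\mapsto D_1(P\|Q_\theta)$ has positive definite Hessian at $\hat\theta^1$. *)

theory Defs
  imports
    "HOL-Analysis.Analysis"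
    "HOL-Probability.Probability"
    "HOL-Combinatorics.Permutations"
    "HOL-Computational_Algebra.Polynomial"
begin

section \<open>Distributions on words\<close>

text \<open>The finite alphabet is the type \<open>'x\<close>, and a sequence \<open>x\<^sup>n\<close> is a list of length \<open>n\<close>.
  The product distribution is \<^const>\<open>replicate_pmf\<close>; see \<open>pmf_replicate_pmf\<close> below.\<close>

definition words :: "nat \<Rightarrow> 'x list set" where
  "words n = {xs. length xs = n}"

definition word_pmfs :: "nat \<Rightarrow> 'x list pmf set" where
  "word_pmfs n = {q. set_pmf q \<subseteq> words n}"

lemma finite_words: "finite (words n :: 'x::finite list set)"
  using finite_lists_length_eq[of "UNIV :: 'x set" n] by (simp add: words_def)

lemma pmf_replicate_pmf:
  "pmf (replicate_pmf n p) xs = (if length xs = n then \<Prod>i<n. pmf p (xs ! i) else 0)"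
proof (induction n arbitrary: xs)
  case 0
  then show ?case by (auto simp: indicator_def)
next
  case (Suc n)
  have eq: "replicate_pmf (Suc n) p = map_pmf (\<lambda>(y, ys). y # ys) (pair_pmf p (replicate_pmf n p))"
    by (simp add: pair_pmf_def map_bind_pmf bind_assoc_pmf bind_return_pmf)
  show ?case
  proof (cases xs)
    case Nil
    then show ?thesis
      by (simp add: pmf_eq_0_set_pmf set_replicate_pmf del: replicate_pmf.simps)
  next
    case (Cons y ys)
    have inj: "inj (\<lambda>(y, ys). y # ys :: 'a list)"
      by (auto simp: inj_on_def)
    have "pmf (replicate_pmf (Suc n) p) xs
        = pmf (map_pmf (\<lambda>(y, ys). y # ys) (pair_pmf p (replicate_pmf n p)))
            ((\<lambda>(y, ys). y # ys) (y, ys))"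
      using Cons by (simp add: eq del: replicate_pmf.simps)
    also have "\<dots> = pmf p y * pmf (replicate_pmf n p) ys"
      by (subst pmf_map_inj'[OF inj]) (simp add: pmf_pair)
    also have "\<dots> = (if length xs = Suc n then \<Prod>i<Suc n. pmf p (xs ! i) else 0)"
      using Cons by (subst prod.lessThan_Suc_shift) (simp add: Suc.IH)
    finally show ?thesis .
  qed
qed

text \<open>The alternative \<open>\<Q>\<close> is \<open>\<Q>\<^sub>1\<close>, with words of length one identified with letters.\<close>

definition letter_set :: "(nat \<Rightarrow> 'x list pmf set) \<Rightarrow> 'x pmf set" where
  "letter_set Qn = {q. map_pmf (\<lambda>x. [x]) q \<in> Qn 1}"


section \<open>Permutations\<close>

text \<open>The distribution \<open>P\<^sup>n W\<^sup>n[\<pi>]\<close>. The inverse makes the mass at \<open>(x\<^sub>1, \<dots>, x\<^sub>n)\<close> equal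
  to the mass of \<open>p\<close> at \<open>(x\<^bsub>\<pi>(1)\<^esub>, \<dots>, x\<^bsub>\<pi>(n)\<^esub>)\<close>; see \<open>pmf_permute_pmf\<close>.\<close>

definition permute_pmf :: "(nat \<Rightarrow> nat) \<Rightarrow> 'x list pmf \<Rightarrow> 'x list pmf" where
  "permute_pmf \<pi> p = map_pmf (permute_list (inv \<pi>)) p"

definition sym_pmfs :: "nat \<Rightarrow> 'x list pmf set" where
  "sym_pmfs n = {q \<in> word_pmfs n. \<forall>\<pi>. \<pi> permutes {..<n} \<longrightarrow> permute_pmf \<pi> q = q}"

definition symmetrize_pmf :: "nat \<Rightarrow> 'x list pmf \<Rightarrow> 'x list pmf" where
  "symmetrize_pmf n p = bind_pmf (pmf_of_set {\<pi>. \<pi> permutes {..<n}}) (\<lambda>\<pi>. permute_pmf \<pi> p)"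

lemma pmf_permute_pmf:
  assumes \<pi>: "\<pi> permutes {..<n}" and p: "p \<in> word_pmfs n" and xs: "xs \<in> words n"
  shows "pmf (permute_pmf \<pi> p) xs = pmf p (permute_list \<pi> xs)"
proof -
  have \<pi>': "inv \<pi> permutes {..<n}"
    using \<pi> by (rule permutes_inv)
  have left: "permute_list \<pi> (permute_list (inv \<pi>) ys) = ys" if "ys \<in> words n" for ys :: "'a list"
    using that \<pi> permute_list_compose[of \<pi> ys "inv \<pi>"] permutes_inv_o[OF \<pi>]
    by (metis (mono_tags, lifting) \<pi>' mem_Collect_eq permute_list_compose permute_list_id words_def)
  have right: "permute_list (inv \<pi>) (permute_list \<pi> ys) = ys" if "ys \<in> words n" for ys :: "'a list"
    using that \<pi> permutes_inv_o[OF \<pi>]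
    by (metis (mono_tags, lifting) \<pi>' mem_Collect_eq permute_list_compose permute_list_id words_def)
  have "pmf (permute_pmf \<pi> p) xs = measure p (permute_list (inv \<pi>) -` {xs} \<inter> set_pmf p)"
    by (simp add: permute_pmf_def pmf_map measure_Int_set_pmf)
  also have "permute_list (inv \<pi>) -` {xs} \<inter> set_pmf p = {permute_list \<pi> xs} \<inter> set_pmf p"
    using p xs left right by (auto simp: word_pmfs_def)
  also have "measure p \<dots> = pmf p (permute_list \<pi> xs)"
    by (simp add: measure_Int_set_pmf measure_pmf_single)
  finally show ?thesis .
qed

lemma pmf_symmetrize_pmf:
  assumes "p \<in> word_pmfs n" "xs \<in> words n"
  shows "pmf (symmetrize_pmf n p) xs
    = (1 / fact n) * (\<Sum>\<pi> | \<pi> permutes {..<n}. pmf p (permute_list \<pi> xs))"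
proof -
  have fin: "finite {\<pi>. \<pi> permutes {..<n}}"
    by (simp add: finite_permutations)
  have ne: "{\<pi>. \<pi> permutes {..<n}} \<noteq> {}"
    using permutes_id by blast
  have card: "card {\<pi>. \<pi> permutes {..<n}} = fact n"
    by (simp add: card_permutations)
  have "pmf (symmetrize_pmf n p) xs
      = (\<Sum>\<pi> | \<pi> permutes {..<n}. pmf (permute_pmf \<pi> p) xs) / fact n"
    using fin ne card
    by (simp add: symmetrize_pmf_def pmf_bind integral_pmf_of_set)
  also have "\<dots> = (\<Sum>\<pi> | \<pi> permutes {..<n}. pmf p (permute_list \<pi> xs)) / fact n"
    using assms by (simp add: pmf_permute_pmf)
  finally show ?thesis by simp
qed


section \<open>Renyi divergence\<close>

text \<open>Throughout, \<open>b > 1\<close> is the common base of logarithm and exponential.\<close>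

definition elog :: "real \<Rightarrow> ereal \<Rightarrow> ereal" where
  "elog b x = (if x = \<infinity> then \<infinity> else if x \<le> 0 then -\<infinity> else ereal (log b (real_of_ereal x)))"

text \<open>The distributions below all have finite support. For \<open>s < 1\<close> the convention
  \<^term>\<open>0 powr (1 - s) = (0::real)\<close> is the intended value at points where \<open>Q\<close> vanishes.\<close>

definition renyi_sum :: "real \<Rightarrow> 'a pmf \<Rightarrow> 'a pmf \<Rightarrow> ereal" where
  "renyi_sum s P Q =
     (if s > 1 \<and> (\<exists>x. pmf Q x = 0 \<and> 0 < pmf P x) then \<infinity>
      else ereal (\<Sum>x | pmf P x > 0. pmf P x powr s * pmf Q x powr (1 - s)))"

definition renyi_div :: "real \<Rightarrow> real \<Rightarrow> 'a pmf \<Rightarrow> 'a pmf \<Rightarrow> ereal" where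
  "renyi_div b s P Q =
     (if s = 1
      then \<Sum>x | pmf P x > 0. ereal (pmf P x) * (elog b (ereal (pmf P x)) - elog b (ereal (pmf Q x)))
      else ereal (1 / (s - 1)) * elog b (renyi_sum s P Q))"

definition renyi_div_set :: "real \<Rightarrow> real \<Rightarrow> 'a pmf \<Rightarrow> 'a pmf set \<Rightarrow> ereal" where
  "renyi_div_set b s P QQ = (INF Q\<in>QQ. renyi_div b s P Q)"

definition phi :: "real \<Rightarrow> 'a pmf \<Rightarrow> 'a pmf set \<Rightarrow> real \<Rightarrow> real" where
  "phi b P QQ s = real_of_ereal (ereal (s - 1) * renyi_div_set b s P QQ)"

definition critical_rate :: "real \<Rightarrow> real \<Rightarrow> 'a pmf \<Rightarrow> 'a pmf set \<Rightarrow> ereal" where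
  "critical_rate b a P QQ =
     Lim (at_right a) (\<lambda>s. ereal (s * deriv (phi b P QQ) s - phi b P QQ s))"


section \<open>Hypothesis testing\<close>

text \<open>Only the values of a test on \<^term>\<open>words n\<close> matter.\<close>

definition tests :: "('x list \<Rightarrow> real) set" where
  "tests = {T. \<forall>xs. 0 \<le> T xs \<and> T xs \<le> 1}"

definition type1_error :: "nat \<Rightarrow> 'x list pmf \<Rightarrow> ('x list \<Rightarrow> real) \<Rightarrow> real" where
  "type1_error n p T = (\<Sum>xs\<in>words n. pmf p xs * (1 - T xs))"

definition type2_error :: "nat \<Rightarrow> 'x list pmf set \<Rightarrow> ('x list \<Rightarrow> real) \<Rightarrow> ereal" where
  "type2_error n QQ T = (SUP q\<in>QQ. ereal (\<Sum>xs\<in>words n. pmf q xs * T xs))"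

text \<open>The infimum is a minimum, see \<open>optimal_type1_error_attained\<close>.\<close>

definition optimal_type1_error :: "nat \<Rightarrow> real \<Rightarrow> 'x list pmf \<Rightarrow> 'x list pmf set \<Rightarrow> real" where
  "optimal_type1_error n \<mu> p QQ =
     Inf {type1_error n p T |T. T \<in> tests \<and> type2_error n QQ T \<le> ereal \<mu>}"

lemma optimal_type1_error_attained:
  fixes p :: "'x::finite list pmf"
  assumes "0 \<le> \<mu>"
  obtains T where "T \<in> tests" "type2_error n QQ T \<le> ereal \<mu>"
    "type1_error n p T = optimal_type1_error n \<mu> p QQ"
    "\<And>T'. T' \<in> tests \<Longrightarrow> type2_error n QQ T' \<le> ereal \<mu> \<Longrightarrow> type1_error n p T \<le> type1_error n p T'"
proof -
  define F where "F = {T :: 'x list \<Rightarrow> real. T \<in> tests \<and> type2_error n QQ T \<le> ereal \<mu>}"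
  have coord: "continuous_on UNIV (\<lambda>T :: 'x list \<Rightarrow> real. T xs)" for xs
    by (rule continuous_on_product_coordinates)
  have F_eq: "F = tests \<inter> (\<Inter>q\<in>QQ. {T. (\<Sum>xs\<in>words n. pmf q xs * T xs) \<le> \<mu>})"
    by (auto simp: F_def type2_error_def SUP_le_iff)
  have "compact (tests :: ('x list \<Rightarrow> real) set)"
  proof -
    have "tests = PiE UNIV (\<lambda>_ :: 'x list. {0..1 :: real})"
      by (auto simp: tests_def PiE_def Pi_def)
    moreover have "compactin (product_topology (\<lambda>_. euclidean) UNIV)
        (PiE UNIV (\<lambda>_ :: 'x list. {0..1 :: real}))"
      by (subst compactin_PiE) auto
    ultimately show ?thesis
      by (simp add: euclidean_product_topology)
  qed
  moreover have "closed (\<Inter>q\<in>QQ. {T. (\<Sum>xs\<in>words n. pmf q xs * T xs) \<le> \<mu>})"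
    by (intro closed_INT ballI closed_Collect_le continuous_intros coord)
  ultimately have comp: "compact F"
    unfolding F_eq by (rule compact_Int_closed)
  have "(\<lambda>_. 0) \<in> F"
    using assms by (auto simp: F_def tests_def type2_error_def SUP_le_iff)
  then have ne: "F \<noteq> {}" by blast
  have cont: "continuous_on F (type1_error n p)"
    unfolding type1_error_def
    by (intro continuous_intros continuous_on_subset[OF coord]) auto
  obtain T where T: "T \<in> F" "\<And>T'. T' \<in> F \<Longrightarrow> type1_error n p T \<le> type1_error n p T'"
    using continuous_attains_inf[OF comp ne cont] by blast
  have "optimal_type1_error n \<mu> p QQ = type1_error n p T"
    unfolding optimal_type1_error_def
    by (rule cInf_eq_minimum) (use T in \<open>auto simp: F_def\<close>)
  with T show thesis
    by (intro that[of T]) (auto simp: F_def)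
qed

definition error_exponent :: "real \<Rightarrow> real \<Rightarrow> 'x pmf \<Rightarrow> (nat \<Rightarrow> 'x list pmf set) \<Rightarrow> ereal" where
  "error_exponent b R P Qn =
     liminf (\<lambda>n. ereal (- (1 / real n)) *
       elog b (ereal (optimal_type1_error n (b powr (- (real n * R))) (replicate_pmf n P) (Qn n))))"


section \<open>Axioms on the alternative\<close>

definition contains_products :: "(nat \<Rightarrow> 'x list pmf set) \<Rightarrow> bool" where
  "contains_products Qn \<longleftrightarrow> (\<forall>q\<in>letter_set Qn. \<forall>n\<ge>1. replicate_pmf n q \<in> Qn n)"

definition renyi_superadditive :: "real \<Rightarrow> real set \<Rightarrow> 'x pmf \<Rightarrow> (nat \<Rightarrow> 'x list pmf set) \<Rightarrow> bool" where
  "renyi_superadditive b J P Qn \<longleftrightarrow>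
     (\<forall>s\<in>J. \<forall>n\<ge>1. renyi_div_set b s (replicate_pmf n P) (Qn n)
        \<ge> ereal (real n) * renyi_div_set b s P (letter_set Qn))"

definition has_universal_pmf :: "real \<Rightarrow> real set \<Rightarrow> 'x pmf \<Rightarrow> (nat \<Rightarrow> 'x list pmf set) \<Rightarrow> bool" where
  "has_universal_pmf b J P Qn \<longleftrightarrow>
     (\<exists>(U :: nat \<Rightarrow> 'x list pmf) (v :: real poly). \<forall>n\<ge>1.
        U n \<in> sym_pmfs n \<and>
        (\<forall>q \<in> Qn n \<inter> sym_pmfs n. \<forall>xs\<in>words n. pmf q xs \<le> poly v (real n) * pmf (U n) xs) \<and>
        (\<forall>s\<in>J. renyi_div b s (replicate_pmf n P) (U n)
           \<ge> renyi_div_set b s (replicate_pmf n P) (Qn n))) \<and>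
     (\<forall>n\<ge>1. \<forall>p\<in>Qn n. symmetrize_pmf n p \<in> Qn n \<inter> sym_pmfs n)"

text \<open>Since \<open>\<Theta>\<close> need not have interior points in the ambient space, derivatives are taken
  within \<open>\<Theta>\<close>. They are then determined only along \<open>tangent_space \<Theta>\<close>, and definiteness of a
  Hessian refers to these directions.\<close>

definition C2_on :: "'v::real_normed_vector set \<Rightarrow> ('v \<Rightarrow> real) \<Rightarrow> bool" where
  "C2_on S f \<longleftrightarrow>
     (\<exists>(f' :: 'v \<Rightarrow> 'v \<Rightarrow>\<^sub>L real) (f'' :: 'v \<Rightarrow> 'v \<Rightarrow>\<^sub>L 'v \<Rightarrow>\<^sub>L real).
        (\<forall>t\<in>S. (f has_derivative blinfun_apply (f' t)) (at t within S) \<and>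
               (f' has_derivative blinfun_apply (f'' t)) (at t within S)) \<and>
        continuous_on S f'')"

definition tangent_space :: "'v::real_vector set \<Rightarrow> 'v set" where
  "tangent_space S = {u - w |u w. u \<in> affine hull S \<and> w \<in> affine hull S}"

text \<open>An extended real-valued function has a Hessian at a point only if it is finite near it.\<close>

definition has_hessian_within ::
    "('v::real_normed_vector \<Rightarrow> ereal) \<Rightarrow> ('v \<Rightarrow>\<^sub>L 'v \<Rightarrow>\<^sub>L real) \<Rightarrow> 'v \<Rightarrow> 'v set \<Rightarrow> bool" where
  "has_hessian_within f H t S \<longleftrightarrow>
     (\<exists>(F :: 'v \<Rightarrow> real) (F' :: 'v \<Rightarrow> 'v \<Rightarrow>\<^sub>L real).
        (\<forall>\<^sub>F u in inf (nhds t) (principal S).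
           f u = ereal (F u) \<and> (F has_derivative blinfun_apply (F' u)) (at u within S)) \<and>
        (F' has_derivative blinfun_apply H) (at t within S))"

definition pos_def_hessian :: "('v::real_normed_vector \<Rightarrow> ereal) \<Rightarrow> 'v \<Rightarrow> 'v set \<Rightarrow> bool" where
  "pos_def_hessian f t S \<longleftrightarrow>
     (\<exists>H. has_hessian_within f H t S \<and>
        (\<forall>v\<in>tangent_space S. v \<noteq> 0 \<longrightarrow> blinfun_apply (blinfun_apply H v) v > 0))"

definition neg_def_hessian :: "('v::real_normed_vector \<Rightarrow> ereal) \<Rightarrow> 'v \<Rightarrow> 'v set \<Rightarrow> bool" where
  "neg_def_hessian f t S \<longleftrightarrow>
     (\<exists>H. has_hessian_within f H t S \<and>
        (\<forall>v\<in>tangent_space S. v \<noteq> 0 \<longrightarrow> blinfun_apply (blinfun_apply H v) v < 0))"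

definition regular_parametrization ::
    "real \<Rightarrow> real set \<Rightarrow> 'x pmf \<Rightarrow> (nat \<Rightarrow> 'x list pmf set) \<Rightarrow>
     'v::euclidean_space set \<Rightarrow> ('v \<Rightarrow> 'x pmf) \<Rightarrow> bool" where
  "regular_parametrization b J P Qn \<Theta> Qt \<longleftrightarrow>
     compact \<Theta> \<and> convex \<Theta> \<and>
     (\<forall>x. C2_on \<Theta> (\<lambda>t. pmf (Qt t) x)) \<and>
     letter_set Qn = Qt ` \<Theta> \<and>
     (\<forall>s\<in>J. \<exists>!t. is_arg_min (\<lambda>t. renyi_div b s P (Qt t)) (\<lambda>t. t \<in> \<Theta>) t) \<and>
     (\<forall>s\<in>J. \<forall>t. is_arg_min (\<lambda>t. renyi_div b s P (Qt t)) (\<lambda>t. t \<in> \<Theta>) t \<longrightarrow>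
        t \<in> rel_interior \<Theta> \<and>
        (s < 1 \<longrightarrow> neg_def_hessian (\<lambda>t. renyi_sum s P (Qt t)) t \<Theta>) \<and>
        (s > 1 \<longrightarrow> pos_def_hessian (\<lambda>t. renyi_sum s P (Qt t)) t \<Theta>) \<and>
        (s = 1 \<longrightarrow> pos_def_hessian (\<lambda>t. renyi_div b 1 P (Qt t)) t \<Theta>))"

end

theory Submission
  imports Defs
begin

text \<open>For a fixed order \<open>s\<close>, the likelihood ratio test of \<open>P\<^sup>n\<close> against the universal
  distribution \<open>U\<^sup>n\<close> gives the lower bound on the exponent by Markov-type estimates.
  Conversely, one tests against the single product distribution whose parameter is the minimizer at
  order \<open>s\<close>; changing measure to the tilted distribution proportional to \<open>P\<^sup>s Q\<^bsup>1-s\<^esup>\<close> and applying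
  the weak law of large numbers bounds the exponent by
  \<open>(1 - s)/s (D\<^sub>s - R) + (1 - s)/s (R - N(s))\<close> whenever \<open>N(s) = s \<phi>'(s) - \<phi>(s) < R\<close>.
  Uniqueness of the minimizer and compactness of \<open>\<Theta>\<close> make \<open>\<phi>\<close> a differentiable convex function,
  so \<open>N\<close> is continuous and nondecreasing, and \<open>R > R\<^sub>a\<close> yields orders for which the
  second term is arbitrarily small: either \<open>N(s)\<close> approaches \<open>R\<close>, or \<open>s\<close> can tend to one.\<close>

section \<open>Sums over words of fixed length\<close>

lemma sum_words_Suc:
  fixes F :: "'x::finite list \<Rightarrow> real"
  shows "(\<Sum>xs\<in>words (Suc n). F xs) = (\<Sum>x\<in>UNIV. \<Sum>ys\<in>words n. F (x # ys))"
proof -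
  have eq: "words (Suc n) = (\<lambda>(x, ys). x # ys) ` (UNIV \<times> words n :: ('x \<times> 'x list) set)"
    by (auto simp: words_def length_Suc_conv image_def)
  have inj: "inj_on (\<lambda>(x, ys). x # ys) (UNIV \<times> words n :: ('x \<times> 'x list) set)"
    by (auto simp: inj_on_def)
  show ?thesis
    unfolding eq by (subst sum.reindex[OF inj]) (simp add: sum.cartesian_product case_prod_beta)
qed

lemma words_0: "words 0 = {[]}"
  by (auto simp: words_def)

lemma pmf_replicate_pmf_prod_list:
  "length xs = n \<Longrightarrow> pmf (replicate_pmf n p) xs = prod_list (map (pmf p) xs)"
  by (simp add: pmf_replicate_pmf prod.list_conv_set_nth atLeast0LessThan)

section \<open>Weak law of large numbers on words\<close>

lemma sum_words_prod_list:
  fixes w :: "'x::finite \<Rightarrow> real"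
  assumes "(\<Sum>x\<in>UNIV. w x) = 1"
  shows "(\<Sum>xs\<in>words n. prod_list (map w xs)) = 1"
  using assms
  by (induction n) (simp_all add: words_0 sum_words_Suc flip: sum_distrib_left)

text \<open>Letters are independent under a product weight. After splitting off the first letter,
  the cross term of the squared sum vanishes because both of its factors have mean zero, so
  variances add. Weights are plain functions so that tilted weights can be inserted
  directly.\<close>

lemma sum_words_prod_list_centred:
  fixes w h :: "'x::finite \<Rightarrow> real"
  assumes w: "(\<Sum>x\<in>UNIV. w x) = 1" and h: "(\<Sum>x\<in>UNIV. w x * h x) = 0"
  shows "(\<Sum>xs\<in>words n. prod_list (map w xs) * sum_list (map h xs)) = 0"
    and "(\<Sum>xs\<in>words n. prod_list (map w xs) * (sum_list (map h xs))\<^sup>2)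
      = real n * (\<Sum>x\<in>UNIV. w x * (h x)\<^sup>2)"
proof -
  let ?w = "\<lambda>xs. prod_list (map w xs)" and ?h = "\<lambda>xs. sum_list (map h xs)"
  have one: "(\<Sum>xs\<in>words n. ?w xs) = 1" for n
    by (rule sum_words_prod_list[OF w])
  show first: "(\<Sum>xs\<in>words n. ?w xs * ?h xs) = 0" for n
  proof (induction n)
    case (Suc n)
    have "(\<Sum>ys\<in>words n. ?w (x # ys) * ?h (x # ys))
        = w x * h x * (\<Sum>ys\<in>words n. ?w ys) + w x * (\<Sum>ys\<in>words n. ?w ys * ?h ys)" for x
      by (simp add: sum_distrib_left sum.distrib algebra_simps)
    then show ?case
      using Suc h by (simp add: sum_words_Suc one)
  qed (simp add: words_0)
  show "(\<Sum>xs\<in>words n. ?w xs * (?h xs)\<^sup>2) = real n * (\<Sum>x\<in>UNIV. w x * (h x)\<^sup>2)"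
  proof (induction n)
    case (Suc n)
    have "(\<Sum>ys\<in>words n. ?w (x # ys) * (?h (x # ys))\<^sup>2)
        = w x * (h x)\<^sup>2 * (\<Sum>ys\<in>words n. ?w ys) + 2 * w x * h x * (\<Sum>ys\<in>words n. ?w ys * ?h ys)
          + w x * (\<Sum>ys\<in>words n. ?w ys * (?h ys)\<^sup>2)" for x
      by (simp add: sum_distrib_left sum.distrib algebra_simps power2_eq_square)
    then have "(\<Sum>xs\<in>words (Suc n). ?w xs * (?h xs)\<^sup>2)
        = (\<Sum>x\<in>UNIV. w x * (h x)\<^sup>2) + (\<Sum>x\<in>UNIV. w x) * (\<Sum>ys\<in>words n. ?w ys * (?h ys)\<^sup>2)"
      by (simp add: sum_words_Suc one first sum.distrib sum_distrib_right)
    then show ?case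
      using Suc w by (simp add: algebra_simps)
  qed (simp add: words_0)
qed

lemma sum_list_diff_const:
  "sum_list (map (\<lambda>x. h x - m) xs) = sum_list (map h xs) - real (length xs) * m"
  by (induction xs) (simp_all add: algebra_simps)

lemma prod_list_map_nonneg:
  fixes w :: "'a \<Rightarrow> real"
  shows "(\<And>x. 0 \<le> w x) \<Longrightarrow> 0 \<le> prod_list (map w xs)"
  by (auto intro!: prod_list_nonneg)

text \<open>Chebyshev's inequality: on the deviating words the squared centred sum is at least
  \<open>(n \<epsilon>)^2\<close>, while its mean is \<open>n\<close> times the variance of one
  letter. Only upward deviations are treated, since likelihood ratios will be bounded from
  above.\<close>

lemma weak_law_words:
  fixes w h :: "'x::finite \<Rightarrow> real"
  assumes w: "(\<Sum>x\<in>UNIV. w x) = 1" "\<And>x. 0 \<le> w x" and "0 < \<epsilon>"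
  shows "(\<lambda>n. \<Sum>xs | xs \<in> words n \<and> real n * ((\<Sum>x\<in>UNIV. w x * h x) + \<epsilon>) < sum_list (map h xs).
      prod_list (map w xs)) \<longlonglongrightarrow> 0"
proof -
  define m where "m = (\<Sum>x\<in>UNIV. w x * h x)"
  define var where "var = (\<Sum>x\<in>UNIV. w x * (h x - m)\<^sup>2)"
  let ?B = "\<lambda>n. {xs \<in> words n. real n * (m + \<epsilon>) < sum_list (map h xs)}"
  have centred: "(\<Sum>x\<in>UNIV. w x * (h x - m)) = 0"
    using w(1) by (simp add: right_diff_distrib sum_subtractf m_def flip: sum_distrib_right)
  have bound: "(\<Sum>xs\<in>?B n. prod_list (map w xs)) \<le> var / \<epsilon>\<^sup>2 / real n" if "n > 0" for n
  proof -
    have "(\<Sum>xs\<in>?B n. prod_list (map w xs)) * (real n * \<epsilon>)\<^sup>2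
        \<le> (\<Sum>xs\<in>?B n. prod_list (map w xs) * (sum_list (map (\<lambda>x. h x - m) xs))\<^sup>2)"
      unfolding sum_distrib_right
    proof (intro sum_mono mult_left_mono)
      fix xs assume "xs \<in> ?B n"
      then show "(real n * \<epsilon>)\<^sup>2 \<le> (sum_list (map (\<lambda>x. h x - m) xs))\<^sup>2"
        using \<open>0 < \<epsilon>\<close> unfolding sum_list_diff_const
        by (intro power_mono) (auto simp: words_def algebra_simps)
    qed (rule prod_list_map_nonneg[OF w(2)])
    also have "\<dots> \<le> (\<Sum>xs\<in>words n. prod_list (map w xs) * (sum_list (map (\<lambda>x. h x - m) xs))\<^sup>2)"
      by (intro sum_mono2) (auto simp: finite_words prod_list_map_nonneg[OF w(2)])
    also have "\<dots> = real n * var"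
      unfolding var_def by (rule sum_words_prod_list_centred(2)[OF w(1) centred])
    finally have "(\<Sum>xs\<in>?B n. prod_list (map w xs)) * (real n * \<epsilon>)\<^sup>2 \<le> real n * var" .
    then show ?thesis
      using that \<open>0 < \<epsilon>\<close> by (simp add: field_simps power2_eq_square)
  qed
  have "(\<lambda>n. var / \<epsilon>\<^sup>2 / real n) \<longlonglongrightarrow> 0"
    by (rule lim_const_over_n)
  then have "(\<lambda>n. \<Sum>xs\<in>?B n. prod_list (map w xs)) \<longlonglongrightarrow> 0"
  proof (rule tendsto_sandwich[rotated 3])
    show "\<forall>\<^sub>F n in sequentially. 0 \<le> (\<Sum>xs\<in>?B n. prod_list (map w xs))"
      by (intro always_eventually allI sum_nonneg prod_list_map_nonneg w(2))
    show "\<forall>\<^sub>F n in sequentially. (\<Sum>xs\<in>?B n. prod_list (map w xs)) \<le> var / \<epsilon>\<^sup>2 / real n"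
      using eventually_gt_at_top[of 0] by eventually_elim (rule bound)
  qed simp
  then show ?thesis by (simp add: m_def)
qed

lemma prod_list_likelihood_ratio:
  fixes w q :: "'x \<Rightarrow> real"
  assumes "\<And>x. x \<in> set xs \<Longrightarrow> 0 < w x \<and> 0 < q x"
  shows "prod_list (map w xs)
    = exp (sum_list (map (\<lambda>x. ln (w x) - ln (q x)) xs)) * prod_list (map q xs)"
  using assms
proof (induction xs)
  case (Cons x xs)
  have "0 < w x" "0 < q x" using Cons.prems[of x] by simp_all
  then have "exp (ln (w x) - ln (q x)) * q x = w x" by (simp add: exp_diff)
  moreover have "prod_list (map w xs)
      = exp (sum_list (map (\<lambda>x. ln (w x) - ln (q x)) xs)) * prod_list (map q xs)"
    using Cons by simp
  ultimately show ?case by (simp add: exp_add)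
qed simp

section \<open>Change of measure\<close>

text \<open>Under \<open>w\<close> most words have likelihood ratios to \<open>Q\<close> and to
  \<open>P\<close> that hardly exceed their typical exponents. On those words a test of small
  \<open>Q\<close>-mass has exponentially small \<open>w\<close>-mass, because \<open>r\<close>
  exceeds the divergence of \<open>w\<close> from \<open>Q\<close>. So \<open>w\<close> mostly
  rejects, and passing from \<open>w\<close> to \<open>P\<close> costs the divergence of
  \<open>w\<close> from \<open>P\<close> in the exponent.\<close>

lemma type1_error_lower_bound:
  fixes P Q :: "'x::finite pmf" and w :: "'x \<Rightarrow> real"
  assumes w: "(\<Sum>x\<in>UNIV. w x) = 1" "\<And>x. 0 \<le> w x"
    and supp: "\<And>x. 0 < w x \<Longrightarrow> 0 < pmf P x \<and> 0 < pmf Q x"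
    and rate: "(\<Sum>x\<in>UNIV. w x * (ln (w x) - ln (pmf Q x))) < r" and "0 < \<epsilon>"
  shows "\<forall>\<^sub>F n in sequentially. \<forall>T\<in>tests.
      (\<Sum>xs\<in>words n. pmf (replicate_pmf n Q) xs * T xs) \<le> exp (- (real n * r)) \<longrightarrow>
      exp (- (real n * ((\<Sum>x\<in>UNIV. w x * (ln (w x) - ln (pmf P x))) + \<epsilon>))) / 2
        \<le> type1_error n (replicate_pmf n P) T"
proof -
  let ?hQ = "\<lambda>x. ln (w x) - ln (pmf Q x)" and ?hP = "\<lambda>x. ln (w x) - ln (pmf P x)"
  define dQ where "dQ = (\<Sum>x\<in>UNIV. w x * ?hQ x)"
  define dP where "dP = (\<Sum>x\<in>UNIV. w x * ?hP x)"
  \<comment> \<open>Half of the gap between \<open>dQ\<close> and \<open>r\<close> is the tolerance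
    for typical words; the other half survives as a decay rate.\<close>
  define \<delta> where "\<delta> = (r - dQ) / 2"
  have \<delta>: "0 < \<delta>" "dQ + \<delta> - r = - \<delta>"
    using rate unfolding \<delta>_def dQ_def[symmetric] by (simp_all add: field_simps)
  let ?w = "\<lambda>xs. prod_list (map w xs)"
  define BQ where "BQ = (\<lambda>n. {xs \<in> words n. real n * (dQ + \<delta>) < sum_list (map ?hQ xs)})"
  define BP where "BP = (\<lambda>n. {xs \<in> words n. real n * (dP + \<epsilon>) < sum_list (map ?hP xs)})"
  have limQ: "(\<lambda>n. \<Sum>xs\<in>BQ n. ?w xs) \<longlonglongrightarrow> 0"
    unfolding BQ_def dQ_def by (rule weak_law_words[OF w \<delta>(1)])
  have limP: "(\<lambda>n. \<Sum>xs\<in>BP n. ?w xs) \<longlonglongrightarrow> 0"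
    unfolding BP_def dP_def by (rule weak_law_words[OF w \<open>0 < \<epsilon>\<close>])
  have limE: "(\<lambda>n. exp (- \<delta>) ^ n) \<longlonglongrightarrow> 0"
    using \<delta>(1) by (intro LIMSEQ_realpow_zero) auto
  have "(\<lambda>n. (\<Sum>xs\<in>BQ n. ?w xs) + (\<Sum>xs\<in>BP n. ?w xs) + exp (- \<delta>) ^ n) \<longlonglongrightarrow> 0 + 0 + 0"
    by (intro tendsto_add limQ limP limE)
  then have "\<forall>\<^sub>F n in sequentially. (\<Sum>xs\<in>BQ n. ?w xs) + (\<Sum>xs\<in>BP n. ?w xs) + exp (- \<delta>) ^ n < 1/2"
    by (rule order_tendstoD) simp
  then show ?thesis
    unfolding dP_def[symmetric]
  proof (eventually_elim, intro ballI impI)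
    fix n and T :: "'x list \<Rightarrow> real"
    assume small: "(\<Sum>xs\<in>BQ n. ?w xs) + (\<Sum>xs\<in>BP n. ?w xs) + exp (- \<delta>) ^ n < 1/2"
      and T: "T \<in> tests"
      and type2: "(\<Sum>xs\<in>words n. pmf (replicate_pmf n Q) xs * T xs) \<le> exp (- (real n * r))"
    have T01: "0 \<le> T xs" "T xs \<le> 1" for xs
      using T by (auto simp: tests_def)
    have w_nonneg: "0 \<le> ?w xs" for xs
      by (rule prod_list_map_nonneg[OF w(2)])
    have ratio: "?w xs \<le> exp (real n * c) * pmf (replicate_pmf n q) xs"
      if "xs \<in> words n" "\<not> real n * c < sum_list (map (\<lambda>x. ln (w x) - ln (pmf q x)) xs)"
        and pos: "\<And>x. 0 < w x \<Longrightarrow> 0 < pmf q x" for xs c and q :: "'x pmf"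
    \<comment> \<open>A letter of weight zero makes the product weight vanish; otherwise only
      logarithms of positive numbers occur.\<close>
    proof (cases "\<forall>x\<in>set xs. 0 < w x")
      case True
      have "?w xs = exp (sum_list (map (\<lambda>x. ln (w x) - ln (pmf q x)) xs)) * prod_list (map (pmf q) xs)"
        using True pos by (intro prod_list_likelihood_ratio) blast
      also have "\<dots> \<le> exp (real n * c) * prod_list (map (pmf q) xs)"
        using that by (intro mult_right_mono prod_list_map_nonneg) auto
      finally show ?thesis
        using that(1) by (simp add: pmf_replicate_pmf_prod_list words_def)
    next
      case False
      then have "?w xs = 0"
        using w(2) by (force simp: prod_list_zero_iff not_less intro: antisym)
      then show ?thesis by simp
    qed
    let ?G = "words n - BQ n - BP n"
    have "1 = (\<Sum>xs\<in>words n. ?w xs)"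
      by (rule sum_words_prod_list[OF w(1), symmetric])
    also have "\<dots> \<le> (\<Sum>xs\<in>?G \<union> (BQ n \<union> BP n). ?w xs)"
      by (intro sum_mono2 w_nonneg) (auto simp: finite_words BQ_def BP_def)
    also have "\<dots> \<le> (\<Sum>xs\<in>?G. ?w xs) + ((\<Sum>xs\<in>BQ n. ?w xs) + (\<Sum>xs\<in>BP n. ?w xs))"
    proof -
      have fin: "finite ?G" "finite (BQ n)" "finite (BP n)"
        by (simp_all add: finite_words BQ_def BP_def)
      have sub: "(\<Sum>xs\<in>A \<union> B. ?w xs) \<le> (\<Sum>xs\<in>A. ?w xs) + (\<Sum>xs\<in>B. ?w xs)"
        if "finite A" "finite B" for A B
        using sum.union_inter[OF that, of ?w] sum_nonneg[of "A \<inter> B" ?w] w_nonneg by simp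
      show ?thesis
        using sub[of ?G "BQ n \<union> BP n"] sub[of "BQ n" "BP n"] fin by simp
    qed
    finally have good: "1 - (\<Sum>xs\<in>BQ n. ?w xs) - (\<Sum>xs\<in>BP n. ?w xs) \<le> (\<Sum>xs\<in>?G. ?w xs)"
      by simp
    have "(\<Sum>xs\<in>?G. ?w xs * T xs)
        \<le> (\<Sum>xs\<in>?G. exp (real n * (dQ + \<delta>)) * (pmf (replicate_pmf n Q) xs * T xs))"
      unfolding mult.assoc[symmetric] using supp
      by (intro sum_mono mult_right_mono ratio T01) (auto simp: BQ_def)
    also have "\<dots> \<le> exp (real n * (dQ + \<delta>)) * (\<Sum>xs\<in>words n. pmf (replicate_pmf n Q) xs * T xs)"
      unfolding sum_distrib_left by (intro sum_mono2) (auto simp: finite_words T01)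
    also have "\<dots> \<le> exp (real n * (dQ + \<delta>)) * exp (- (real n * r))"
      using type2 by (intro mult_left_mono) auto
    also have "\<dots> = exp (- \<delta>) ^ n"
      by (simp add: exp_of_nat_mult[symmetric] exp_add[symmetric] \<delta>(2)[symmetric] algebra_simps)
    finally have accepted: "(\<Sum>xs\<in>?G. ?w xs * T xs) \<le> exp (- \<delta>) ^ n" .
    \<comment> \<open>The two atypical sets and the accepted typical words together carry less than
      half of the \<open>w\<close>-mass.\<close>
    have "1/2 \<le> (\<Sum>xs\<in>?G. ?w xs) - (\<Sum>xs\<in>?G. ?w xs * T xs)"
      using good accepted small by linarith
    also have "\<dots> = (\<Sum>xs\<in>?G. ?w xs * (1 - T xs))"
      by (simp add: right_diff_distrib sum_subtractf)
    also have "\<dots> \<le> (\<Sum>xs\<in>?G. exp (real n * (dP + \<epsilon>)) * (pmf (replicate_pmf n P) xs * (1 - T xs)))"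
      unfolding mult.assoc[symmetric] using supp
      by (intro sum_mono mult_right_mono ratio) (auto simp: BP_def T01)
    also have "\<dots> \<le> exp (real n * (dP + \<epsilon>)) * type1_error n (replicate_pmf n P) T"
      unfolding type1_error_def sum_distrib_left
      by (intro sum_mono2) (auto simp: finite_words T01)
    finally have "1/2 \<le> exp (real n * (dP + \<epsilon>)) * type1_error n (replicate_pmf n P) T" .
    moreover have "inverse c / 2 \<le> t" if "1/2 \<le> c * t" "0 < c" for c t :: real
      using that by (simp add: field_simps)
    ultimately show "exp (- (real n * (dP + \<epsilon>))) / 2 \<le> type1_error n (replicate_pmf n P) T"
      unfolding exp_minus by simp
  qed
qed

section \<open>Parametric maxima\<close>

text \<open>By uniqueness the graph of \<open>m\<close> is the set of pairs \<open>(s, t)\<close>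
  with \<open>g s u \<le> g s t\<close> for all \<open>u\<close> in \<open>\<Theta>\<close>. This
  set is closed because \<open>g\<close> is jointly continuous, and a map into a compact set is
  continuous once its graph is closed.\<close>

lemma continuous_on_argmax:
  fixes g :: "'a::euclidean_space \<Rightarrow> 'b::euclidean_space \<Rightarrow> real"
  assumes "compact \<Theta>" and g: "continuous_on (S \<times> \<Theta>) (\<lambda>z. g (fst z) (snd z))"
    and m: "\<And>s. s \<in> S \<Longrightarrow> m s \<in> \<Theta>"
    and max: "\<And>s t. s \<in> S \<Longrightarrow> t \<in> \<Theta> \<Longrightarrow> g s t \<le> g s (m s)"
    and uniq: "\<And>s t. s \<in> S \<Longrightarrow> t \<in> \<Theta> \<Longrightarrow> g s t = g s (m s) \<Longrightarrow> t = m s"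
  shows "continuous_on S m"
proof (cases "S = {}")
  case False
  then have "\<Theta> \<noteq> {}" using m by blast
  have "(\<lambda>s. (s, m s)) ` S
      = (\<Inter>u\<in>\<Theta>. S \<times> \<Theta> \<inter> (\<lambda>z. g (fst z) u - g (fst z) (snd z)) -` {..0})" (is "_ = ?I")
  proof (intro equalityI subsetI)
    fix z assume "z \<in> ?I"
    then have *: "z \<in> S \<times> \<Theta> \<inter> (\<lambda>z. g (fst z) u - g (fst z) (snd z)) -` {..0}" if "u \<in> \<Theta>" for u
      using that by (rule INT_D)
    from \<open>\<Theta> \<noteq> {}\<close> obtain u where "u \<in> \<Theta>" by blast
    from *[OF this] have z: "fst z \<in> S" "snd z \<in> \<Theta>" by (simp_all add: mem_Times_iff)
    have "g (fst z) (m (fst z)) \<le> g (fst z) (snd z)"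
      using *[OF m[OF z(1)]] by simp
    then have "snd z = m (fst z)"
      using max[OF z] by (intro uniq z) simp
    then show "z \<in> (\<lambda>s. (s, m s)) ` S"
      using z(1) by (intro image_eqI[of _ _ "fst z"]) (simp_all add: prod_eq_iff)
  qed (use m max in auto)
  moreover have "closedin (top_of_set (S \<times> \<Theta>)) ?I"
  proof (intro closedin_INT \<open>\<Theta> \<noteq> {}\<close> continuous_closedin_preimage continuous_on_diff g closed_atMost)
    fix u assume "u \<in> \<Theta>"
    moreover have "continuous_on (S \<times> \<Theta>) (\<lambda>z. (fst z, u))"
      by (intro continuous_on_Pair continuous_on_fst continuous_on_id continuous_on_const)
    ultimately show "continuous_on (S \<times> \<Theta>) (\<lambda>z. g (fst z) u)"
      using continuous_on_compose2[OF g, of "S \<times> \<Theta>" "\<lambda>z. (fst z, u)"] by force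
  qed
  ultimately show ?thesis
    using m by (subst continuous_closed_graph_eq[OF \<open>compact \<Theta>\<close>]) auto
qed simp

text \<open>The inequalities at \<open>s\<close> and at \<open>t\<close> enclose the difference
  quotient between \<open>h s\<close> and \<open>h t\<close>, and continuity of \<open>h\<close>
  closes the gap. This serves as an envelope theorem: a maximum over a parameter is differentiated
  without differentiating the maximizer.\<close>

lemma DERIV_of_subgradients:
  fixes f h :: "real \<Rightarrow> real"
  assumes "open S" "s \<in> S"
    and sub: "\<And>s t. s \<in> S \<Longrightarrow> t \<in> S \<Longrightarrow> f s + h s * (t - s) \<le> f t"
    and h: "continuous_on S h"
  shows "(f has_real_derivative h s) (at s)"
proof -
  have near: "\<forall>\<^sub>F t in at s. t \<in> S"
    using assms(1,2) by (rule eventually_at_in_open')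
  have "((\<lambda>t. \<bar>h t - h s\<bar>) \<longlongrightarrow> 0) (at s)"
    using h assms(1,2) by (simp add: continuous_on_eq_continuous_at isCont_def LIM_zero tendsto_rabs_zero)
  moreover have "\<forall>\<^sub>F t in at s. norm ((f t - f s) / (t - s) - h s) \<le> \<bar>h t - h s\<bar>"
    using near eventually_neq_at_within[of s s UNIV]
  proof eventually_elim
    case (elim t)
    let ?q = "(f t - f s) / (t - s)"
    have "h s * (t - s) \<le> f t - f s" "f t - f s \<le> h t * (t - s)"
      using sub[OF \<open>s \<in> S\<close> elim(1)] sub[OF elim(1) \<open>s \<in> S\<close>] by (simp_all add: algebra_simps)
    \<comment> \<open>The sign of \<open>t - s\<close> decides which slope is the lower
      bound.\<close>
    then have "h s \<le> ?q \<and> ?q \<le> h t \<or> h t \<le> ?q \<and> ?q \<le> h s"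
      using elim(2) by (cases "s < t") (auto simp: field_simps)
    then show ?case by auto
  qed
  ultimately have "((\<lambda>t. (f t - f s) / (t - s) - h s) \<longlongrightarrow> 0) (at s)"
    by (rule Lim_null_comparison[rotated])
  then show ?thesis
    by (simp add: has_field_derivative_iff LIM_zero_iff)
qed

text \<open>The quantity is minus the intercept at zero of the supporting line, that is, the
  Legendre transform at slope \<open>h s\<close>. To the right of zero this intercept falls as the
  point of support moves right, because adding the two subgradient inequalities shows
  \<open>h s \<le> h t\<close>.\<close>

lemma legendre_slope_mono:
  fixes f h :: "real \<Rightarrow> real"
  assumes sub: "\<And>s t. s \<in> S \<Longrightarrow> t \<in> S \<Longrightarrow> f s + h s * (t - s) \<le> f t"
    and "s \<in> S" "t \<in> S" "0 \<le> s" "s \<le> t"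
  shows "s * h s - f s \<le> t * h t - f t"
proof (cases "s = t")
  case False
  have 1: "f s + h s * (t - s) \<le> f t" and 2: "f t + h t * (s - t) \<le> f s"
    using sub assms(2,3) by blast+
  then have "(h t - h s) * (t - s) \<ge> 0" by (simp add: algebra_simps)
  then have "h s \<le> h t" using False assms(5) by (simp add: zero_le_mult_iff)
  then have "s * h s \<le> s * h t" using assms(4) by (rule mult_left_mono)
  with 2 show ?thesis by (simp add: algebra_simps)
qed simp

section \<open>Continuity of logarithmic terms up to zero\<close>

lemma continuous_on_x_ln_x: "continuous_on {0..} (\<lambda>x::real. x * ln x)"
  unfolding continuous_on_eq_continuous_within
proof
  fix x :: real assume x: "x \<in> {0..}"
  show "continuous (at x within {0..}) (\<lambda>x. x * ln x)"
  proof (cases "x = 0")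
    case True
    have "((\<lambda>x::real. - (ln (inverse x) / inverse x)) \<longlongrightarrow> - 0) (at_right 0)"
      by (intro tendsto_minus filterlim_compose[OF ln_x_over_x_tendsto_0 filterlim_inverse_at_top_right])
    then have "((\<lambda>x::real. x * ln x) \<longlongrightarrow> 0) (at_right 0)"
      by (simp add: ln_inverse divide_inverse mult.commute)
    then show ?thesis
      using True at_within_Ici_at_right[of "0::real"] by (simp add: continuous_within)
  qed (use x in \<open>auto intro!: continuous_intros\<close>)
qed

text \<open>With \<open>y = f z powr g z\<close> the function is \<open>y * ln y / g z\<close>, so
  the singularity at \<open>f z = 0\<close> is absorbed by \<open>x * ln x\<close>. This handles
  letters to which some parameters give no mass.\<close>

lemma continuous_on_powr_mult_ln:
  fixes f g :: "'a::topological_space \<Rightarrow> real"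
  assumes "continuous_on S f" "continuous_on S g" "\<And>z. z \<in> S \<Longrightarrow> 0 \<le> f z" "\<And>z. z \<in> S \<Longrightarrow> 0 < g z"
  shows "continuous_on S (\<lambda>z. f z powr g z * ln (f z))"
proof -
  have nz: "g z \<noteq> 0" if "z \<in> S" for z
    using assms(4)[OF that] by simp
  have "continuous_on S (\<lambda>z. (f z powr g z) * ln (f z powr g z) / g z)"
    using assms
    by (intro continuous_on_divide continuous_on_compose2[OF continuous_on_x_ln_x] continuous_on_powr')
      (auto simp: nz)
  also have "?this \<longleftrightarrow> ?thesis"
    using nz by (intro continuous_on_cong) auto
  finally show ?thesis .
qed

section \<open>The Hellinger affinity\<close>

text \<open>The real value of \<open>renyi_sum\<close> for orders below one, so that calculus in
  \<open>s\<close> avoids extended reals.\<close>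

definition affinity :: "real \<Rightarrow> 'a pmf \<Rightarrow> 'a pmf \<Rightarrow> real" where
  "affinity s P Q = (\<Sum>x | pmf P x > 0. pmf P x powr s * pmf Q x powr (1 - s))"

text \<open>The derivative of \<open>ln (affinity s P Q)\<close> with respect to \<open>s < 1\<close>. Points where \<open>Q\<close> vanishes
  do not contribute, since \<open>0 powr (1 - s) = 0\<close>.\<close>

definition affinity_slope :: "real \<Rightarrow> 'a pmf \<Rightarrow> 'a pmf \<Rightarrow> real" where
  "affinity_slope s P Q =
     (\<Sum>x | pmf P x > 0. pmf P x powr s * pmf Q x powr (1 - s) * (ln (pmf P x) - ln (pmf Q x)))
       / affinity s P Q"

text \<open>Convexity of a log-sum-exp in the order: the affinity at \<open>t\<close> is the sum of
  \<open>exp ((t - s) * l x)\<close> with the weights of order \<open>s\<close>. The tangent of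
  \<open>exp\<close> at the weighted mean \<open>m\<close> of the exponents bounds it from below,
  and the linear part of that tangent sums to zero.\<close>

lemma ln_affinity_tangent:
  fixes P Q :: "'x::finite pmf"
  assumes "0 < affinity s P Q"
  shows "0 < affinity t P Q"
    and "ln (affinity s P Q) + affinity_slope s P Q * (t - s) \<le> ln (affinity t P Q)"
proof -
  define w where "w = (\<lambda>x. pmf P x powr s * pmf Q x powr (1 - s))"
  define l where "l = (\<lambda>x. ln (pmf P x) - ln (pmf Q x))"
  define W where "W = affinity s P Q"
  define m where "m = affinity_slope s P Q * (t - s)"
  have W: "(\<Sum>x | pmf P x > 0. w x) = W"
    by (simp add: w_def W_def affinity_def)
  have "affinity_slope s P Q * W = (\<Sum>x | pmf P x > 0. w x * l x)"
    using assms by (simp add: affinity_slope_def W_def w_def l_def)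
  then have m: "m * W = (t - s) * (\<Sum>x | pmf P x > 0. w x * l x)"
    by (simp add: m_def mult.commute mult.left_commute)
  \<comment> \<open>Where \<open>Q\<close> vanishes both sides are zero, since zero
    \<open>powr\<close> any exponent is zero.\<close>
  have shift: "pmf P x powr t * pmf Q x powr (1 - t) = w x * exp ((t - s) * l x)" if "pmf P x > 0" for x
  proof (cases "pmf Q x = 0")
    case False
    then show ?thesis
      using that by (simp add: w_def l_def powr_def exp_add[symmetric] algebra_simps)
  qed (simp add: w_def)
  have convex: "exp m * (1 + ((t - s) * y - m)) \<le> exp ((t - s) * y)" for y
  proof -
    have "exp m * (1 + ((t - s) * y - m)) \<le> exp m * exp ((t - s) * y - m)"
      by (intro mult_left_mono exp_ge_add_one_self) simp
    then show ?thesis by (simp add: exp_add[symmetric])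
  qed
  have "exp m * W = exp m * ((1 - m) * (\<Sum>x | pmf P x > 0. w x) + (t - s) * (\<Sum>x | pmf P x > 0. w x * l x))"
    using W m by (simp add: left_diff_distrib)
  also have "\<dots> = (\<Sum>x | pmf P x > 0. w x * (exp m * (1 + ((t - s) * l x - m))))"
    unfolding sum_distrib_left sum.distrib[symmetric] by (intro sum.cong refl) (simp add: algebra_simps)
  also have "\<dots> \<le> (\<Sum>x | pmf P x > 0. w x * exp ((t - s) * l x))"
    by (intro sum_mono mult_left_mono convex) (simp add: w_def)
  also have "\<dots> = affinity t P Q"
    unfolding affinity_def by (intro sum.cong) (auto simp: shift)
  finally have *: "exp m * W \<le> affinity t P Q" .
  have "0 < exp m * W" using assms by (simp add: W_def)
  then show pos: "0 < affinity t P Q" using * by linarith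
  have "ln (exp m * W) \<le> ln (affinity t P Q)"
    using * \<open>0 < exp m * W\<close> pos by simp
  then show "ln (affinity s P Q) + affinity_slope s P Q * (t - s) \<le> ln (affinity t P Q)"
    using assms by (simp add: ln_mult_pos W_def m_def)
qed

lemma continuous_on_affinity:
  fixes P :: "'x::finite pmf" and Q :: "'v::topological_space \<Rightarrow> 'x pmf"
  assumes "\<And>x. continuous_on S (\<lambda>z. pmf (Q z) x)" "continuous_on S \<sigma>" "\<And>z. z \<in> S \<Longrightarrow> \<sigma> z < 1"
  shows "continuous_on S (\<lambda>z. affinity (\<sigma> z) P (Q z))"
  unfolding affinity_def
  using assms by (intro continuous_on_sum continuous_on_mult continuous_on_powr' continuous_on_diff continuous_on_const)
    (auto simp: less_le)

lemma continuous_on_affinity_slope: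
  fixes P :: "'x::finite pmf" and Q :: "'v::topological_space \<Rightarrow> 'x pmf"
  assumes "\<And>x. continuous_on S (\<lambda>z. pmf (Q z) x)" "continuous_on S \<sigma>" "\<And>z. z \<in> S \<Longrightarrow> \<sigma> z < 1"
    and "\<And>z. z \<in> S \<Longrightarrow> 0 < affinity (\<sigma> z) P (Q z)"
  shows "continuous_on S (\<lambda>z. affinity_slope (\<sigma> z) P (Q z))"
  unfolding affinity_slope_def
proof (rule continuous_on_divide)
  show "continuous_on S (\<lambda>z. affinity (\<sigma> z) P (Q z))"
    by (rule continuous_on_affinity[OF assms(1-3)])
  show "continuous_on S (\<lambda>z. \<Sum>x | pmf P x > 0.
      pmf P x powr \<sigma> z * pmf (Q z) x powr (1 - \<sigma> z) * (ln (pmf P x) - ln (pmf (Q z) x)))"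
  proof (intro continuous_on_sum)
    fix x assume "x \<in> {x. 0 < pmf P x}"
    then have a: "continuous_on S (\<lambda>z. pmf P x powr \<sigma> z)"
      using assms(2) by (intro continuous_on_powr' continuous_on_const) auto
    have b: "continuous_on S (\<lambda>z. pmf (Q z) x powr (1 - \<sigma> z))"
      using assms(1-3) by (intro continuous_on_powr' continuous_on_diff continuous_on_const) auto
    have c: "continuous_on S (\<lambda>z. pmf (Q z) x powr (1 - \<sigma> z) * ln (pmf (Q z) x))"
      using assms(1-3) by (intro continuous_on_powr_mult_ln continuous_on_diff continuous_on_const) auto
    \<comment> \<open>Splitting the difference of logarithms leaves \<open>ln (pmf (Q z) x)\<close>
      only beside the power that controls it near zero.\<close>
    have "continuous_on S (\<lambda>z. pmf P x powr \<sigma> z * pmf (Q z) x powr (1 - \<sigma> z) * ln (pmf P x)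
        - pmf P x powr \<sigma> z * (pmf (Q z) x powr (1 - \<sigma> z) * ln (pmf (Q z) x)))"
      by (rule continuous_on_diff[OF continuous_on_mult[OF continuous_on_mult[OF a b] continuous_on_const]
            continuous_on_mult[OF a c]])
    then show "continuous_on S (\<lambda>z. pmf P x powr \<sigma> z * pmf (Q z) x powr (1 - \<sigma> z)
        * (ln (pmf P x) - ln (pmf (Q z) x)))"
      by (simp add: right_diff_distrib mult.assoc)
  qed
qed (metis assms(4) less_irrefl)

section \<open>Permutation invariant tests\<close>

lemma sum_words_permute:
  fixes F :: "'x::finite list \<Rightarrow> real"
  assumes "\<pi> permutes {..<n}"
  shows "(\<Sum>xs\<in>words n. F (permute_list \<pi> xs)) = (\<Sum>xs\<in>words n. F xs)"
proof (rule sum.reindex_bij_betw)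
  have inj: "inj_on (permute_list \<pi>) (words n :: 'x list set)"
  proof (rule inj_on_inverseI)
    fix xs :: "'x list" assume "xs \<in> words n"
    then show "permute_list (inv \<pi>) (permute_list \<pi> xs) = xs"
      using assms permute_list_compose[of "inv \<pi>" xs \<pi>] permutes_inv[OF assms]
      by (simp add: words_def permutes_inv_o[OF assms])
  qed
  have "permute_list \<pi> ` words n \<subseteq> (words n :: 'x list set)"
    by (auto simp: words_def)
  then show "bij_betw (permute_list \<pi>) (words n) (words n :: 'x list set)"
    using inj by (simp add: bij_betw_def endo_inj_surj[OF finite_words])
qed

lemma sum_words_pmf:
  fixes q :: "'x::finite list pmf"
  assumes "q \<in> word_pmfs n"
  shows "(\<Sum>xs\<in>words n. pmf q xs) = 1"
  using assms by (intro sum_pmf_eq_1) (auto simp: word_pmfs_def finite_words)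

lemma pmf_sym_permute_list:
  assumes "q \<in> sym_pmfs n" "\<pi> permutes {..<n}" "xs \<in> words n"
  shows "pmf q (permute_list \<pi> xs) = pmf q xs"
  using assms pmf_permute_pmf[of \<pi> n q xs] by (simp add: sym_pmfs_def)

lemma replicate_pmf_in_sym_pmfs: "replicate_pmf n p \<in> sym_pmfs n"
proof -
  have words: "replicate_pmf n p \<in> word_pmfs n"
    by (auto simp: word_pmfs_def words_def set_replicate_pmf)
  have "permute_pmf \<pi> (replicate_pmf n p) = replicate_pmf n p" if \<pi>: "\<pi> permutes {..<n}" for \<pi>
  proof (rule pmf_eqI)
    fix xs
    show "pmf (permute_pmf \<pi> (replicate_pmf n p)) xs = pmf (replicate_pmf n p) xs"
    proof (cases "xs \<in> words n")
      case True
      then have "mset (permute_list \<pi> xs) = mset xs"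
        using \<pi> by (intro mset_permute_list) (simp add: words_def)
      then have "prod_list (map (pmf p) (permute_list \<pi> xs)) = prod_list (map (pmf p) xs)"
        by (metis mset_map prod_mset_prod_list)
      then show ?thesis
        using True by (simp add: pmf_permute_pmf[OF \<pi> words] pmf_replicate_pmf_prod_list words_def)
    next
      case False
      then have "xs \<notin> set_pmf (permute_pmf \<pi> (replicate_pmf n p))" "xs \<notin> set_pmf (replicate_pmf n p)"
        using words by (auto simp: permute_pmf_def word_pmfs_def words_def)
      then show ?thesis by (simp add: set_pmf_iff)
    qed
  qed
  then show ?thesis using words by (simp add: sym_pmfs_def)
qed

text \<open>A test that ignores the order of letters cannot tell \<open>q\<close> from its
  symmetrization. Type 2 errors can thus be bounded through symmetric members of the alternative,
  which the universal distribution dominates.\<close>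

lemma sum_symmetrize_pmf:
  fixes q :: "'x::finite list pmf"
  assumes "q \<in> word_pmfs n"
    and T: "\<And>\<pi> xs. \<pi> permutes {..<n} \<Longrightarrow> xs \<in> words n \<Longrightarrow> T (permute_list \<pi> xs) = T xs"
  shows "(\<Sum>xs\<in>words n. pmf (symmetrize_pmf n q) xs * T xs) = (\<Sum>xs\<in>words n. pmf q xs * T xs)"
proof -
  let ?S = "{\<pi>. \<pi> permutes {..<n}}"
  have card: "card ?S = fact n"
    by (simp add: card_permutations)
  have "(\<Sum>xs\<in>words n. pmf (symmetrize_pmf n q) xs * T xs)
      = (\<Sum>xs\<in>words n. (1 / fact n) * (\<Sum>\<pi>\<in>?S. pmf q (permute_list \<pi> xs) * T (permute_list \<pi> xs)))"
    by (intro sum.cong refl) (simp add: pmf_symmetrize_pmf[OF assms(1)] T sum_distrib_right)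
  also have "\<dots> = (1 / fact n) *
      (\<Sum>\<pi>\<in>?S. \<Sum>xs\<in>words n. pmf q (permute_list \<pi> xs) * T (permute_list \<pi> xs))"
    by (subst sum.swap) (simp add: sum_distrib_left)
  also have "\<dots> = (1 / fact n) * (\<Sum>\<pi>\<in>?S. \<Sum>xs\<in>words n. pmf q xs * T xs)"
    by (simp add: sum_words_permute[where F = "\<lambda>xs. pmf q xs * T xs"])
  also have "\<dots> = (\<Sum>xs\<in>words n. pmf q xs * T xs)"
    by (simp add: card)
  finally show ?thesis .
qed

section \<open>Achievability\<close>

lemma affinity_words:
  fixes p q :: "'x::finite list pmf"
  assumes "p \<in> word_pmfs n"
  shows "affinity s p q = (\<Sum>xs\<in>words n. pmf p xs powr s * pmf q xs powr (1 - s))"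
  unfolding affinity_def
proof (rule sum.mono_neutral_left)
  show "{xs. 0 < pmf p xs} \<subseteq> words n"
    using assms by (auto simp: word_pmfs_def pmf_positive_iff)
next
  show "\<forall>xs\<in>words n - {xs. 0 < pmf p xs}. pmf p xs powr s * pmf q xs powr (1 - s) = 0"
    using pmf_nonneg[of p] by (auto simp: less_le)
qed (rule finite_words)

lemma optimal_type1_error_le:
  fixes p :: "'x::finite list pmf"
  assumes "T \<in> tests" "type2_error n Q T \<le> ereal \<mu>"
  shows "optimal_type1_error n \<mu> p Q \<le> type1_error n p T"
  unfolding optimal_type1_error_def
proof (rule cInf_lower)
  show "bdd_below {type1_error n p T |T. T \<in> tests \<and> type2_error n Q T \<le> ereal \<mu>}"
    by (rule bdd_belowI[of _ 0])
      (auto simp: type1_error_def tests_def intro!: sum_nonneg mult_nonneg_nonneg)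
qed (use assms in blast)

text \<open>The test accepts where the likelihood ratio of \<open>p\<close> to the dominating \<open>U\<close> exceeds \<open>c\<close>; the
  choice \<open>c\<^sup>s = v g / \<mu>\<close> makes the type 2 bound equal to \<open>\<mu>\<close>.\<close>

lemma optimal_type1_error_upper_bound:
  fixes p U :: "'x::finite list pmf"
  assumes p: "p \<in> sym_pmfs n" and U: "U \<in> sym_pmfs n" and Q: "Q \<subseteq> word_pmfs n"
    and sym: "\<And>q. q \<in> Q \<Longrightarrow> symmetrize_pmf n q \<in> Q \<inter> sym_pmfs n"
    and dom: "\<And>q xs. q \<in> Q \<inter> sym_pmfs n \<Longrightarrow> xs \<in> words n \<Longrightarrow> pmf q xs \<le> v * pmf U xs"
    and s: "0 < s" "s < 1" and pos: "0 < v" "0 < \<mu>" "0 < g" and g: "affinity s p U \<le> g"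
  shows "optimal_type1_error n \<mu> p Q \<le> (v * g / \<mu>) powr ((1 - s) / s) * g"
proof -
  define c where "c = (v * g / \<mu>) powr (1 / s)"
  have c: "0 < c" "c powr s = v * g / \<mu>" "c powr (1 - s) = (v * g / \<mu>) powr ((1 - s) / s)"
    using pos s by (simp_all add: c_def powr_powr)
  define T where "T = (\<lambda>xs. if c * pmf U xs < pmf p xs then 1 else 0 :: real)"
  have T01: "0 \<le> T xs" "T xs \<le> 1" for xs
    by (simp_all add: T_def)
  have T: "T \<in> tests"
    by (simp add: tests_def T01)
  have words: "p \<in> word_pmfs n"
    using p by (simp add: sym_pmfs_def)
  \<comment> \<open>Both error bounds split a mass into powers \<open>s\<close> and
    \<open>1 - s\<close> and use the threshold on one factor: \<open>p\<close> is at most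
    \<open>c U\<close> where \<open>T\<close> rejects, and \<open>c U\<close> is below
    \<open>p\<close> where it accepts.\<close>
  have split: "x = x powr s * x powr (1 - s)" if "0 \<le> x" for x :: real
    using that by (simp add: powr_add[symmetric])
  have type1: "pmf p xs * (1 - T xs) \<le> c powr (1 - s) * (pmf p xs powr s * pmf U xs powr (1 - s))" for xs
  proof (cases "c * pmf U xs < pmf p xs")
    case False
    have "pmf p xs = pmf p xs powr s * pmf p xs powr (1 - s)"
      by (rule split) simp
    also have "\<dots> \<le> pmf p xs powr s * (c * pmf U xs) powr (1 - s)"
      using False s c(1) by (intro mult_left_mono powr_mono2) auto
    finally show ?thesis
      using False c(1) by (simp add: T_def powr_mult mult_ac)
  qed (simp add: T_def)
  have type2: "pmf U xs * T xs \<le> c powr (- s) * (pmf p xs powr s * pmf U xs powr (1 - s))" for xs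
  proof (cases "c * pmf U xs < pmf p xs")
    case True
    have "pmf U xs = c powr (- s) * ((c * pmf U xs) powr s * pmf U xs powr (1 - s))"
      using split[of "pmf U xs"] c(1) by (simp add: powr_mult powr_minus field_simps)
    also have "\<dots> \<le> c powr (- s) * (pmf p xs powr s * pmf U xs powr (1 - s))"
      using True s c(1) by (intro mult_left_mono mult_right_mono powr_mono2) auto
    finally show ?thesis
      using True by (simp add: T_def)
  qed (simp add: T_def)
  have "(\<Sum>xs\<in>words n. pmf q xs * T xs) \<le> \<mu>" if "q \<in> Q" for q
  proof -
    \<comment> \<open>\<open>T\<close> compares two symmetric masses and is therefore invariant
      itself.\<close>
    have "T (permute_list \<pi> xs) = T xs" if "\<pi> permutes {..<n}" "xs \<in> words n" for \<pi> xs
      using that by (simp add: T_def pmf_sym_permute_list[OF p] pmf_sym_permute_list[OF U])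
    then have "(\<Sum>xs\<in>words n. pmf q xs * T xs) = (\<Sum>xs\<in>words n. pmf (symmetrize_pmf n q) xs * T xs)"
      using that Q by (intro sum_symmetrize_pmf[symmetric]) auto
    also have "\<dots> \<le> (\<Sum>xs\<in>words n. v * (pmf U xs * T xs))"
      unfolding mult.assoc[symmetric]
      using dom[OF sym[OF that]] by (intro sum_mono mult_right_mono T01)
    also have "\<dots> \<le> (\<Sum>xs\<in>words n. v * (c powr (- s) * (pmf p xs powr s * pmf U xs powr (1 - s))))"
      using pos(1) by (intro sum_mono mult_left_mono type2) auto
    also have "\<dots> = v * c powr (- s) * affinity s p U"
      by (simp add: affinity_words[OF words] sum_distrib_left mult_ac)
    also have "\<dots> \<le> v * c powr (- s) * g"
      using pos g by (intro mult_left_mono) auto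
    also have "\<dots> = \<mu>"
      using pos by (simp add: powr_minus c(2))
    finally show ?thesis .
  qed
  then have "type2_error n Q T \<le> ereal \<mu>"
    by (auto simp: type2_error_def SUP_le_iff)
  then have "optimal_type1_error n \<mu> p Q \<le> type1_error n p T"
    by (rule optimal_type1_error_le[OF T])
  also have "\<dots> \<le> c powr (1 - s) * affinity s p U"
    unfolding type1_error_def affinity_words[OF words] sum_distrib_left
    by (intro sum_mono type1)
  also have "\<dots> \<le> (v * g / \<mu>) powr ((1 - s) / s) * g"
    unfolding c(3) using g by (intro mult_left_mono) auto
  finally show ?thesis .
qed

text \<open>The polynomial factor lost to the universal distribution is invisible in the exponent:
  it lies between one and \<open>C\<close> times a power of \<open>n\<close>, so its logarithm grows
  at most like \<open>ln n\<close>.\<close>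

lemma ln_poly_over_n_tendsto_0:
  fixes v :: "real poly"
  assumes "\<And>n. 1 \<le> n \<Longrightarrow> 1 \<le> poly v (real n)"
  shows "(\<lambda>n. ln (poly v (real n)) / real n) \<longlonglongrightarrow> 0"
proof -
  define C where "C = (\<Sum>i\<le>degree v. \<bar>coeff v i\<bar>)"
  have upper: "poly v (real n) \<le> C * real n ^ degree v" if "1 \<le> n" for n
  proof -
    have "poly v (real n) \<le> (\<Sum>i\<le>degree v. \<bar>coeff v i\<bar> * real n ^ degree v)"
      unfolding poly_altdef
      using that by (intro sum_mono mult_mono) (auto intro: power_increasing)
    then show ?thesis by (simp add: C_def sum_distrib_right)
  qed
  have "1 \<le> C"
    using upper[of 1] assms[of 1] by simp
  have "(\<lambda>n. ln C / real n + real (degree v) * (ln (real n) / real n)) \<longlonglongrightarrow> 0 + real (degree v) * 0"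
    by (intro tendsto_intros lim_const_over_n)
  then have lim: "(\<lambda>n. ln C / real n + real (degree v) * (ln (real n) / real n)) \<longlonglongrightarrow> 0"
    by simp
  show ?thesis
  proof (rule tendsto_sandwich[OF _ _ tendsto_const lim])
    show "\<forall>\<^sub>F n in sequentially. 0 \<le> ln (poly v (real n)) / real n"
      using eventually_ge_at_top[of 1] by eventually_elim (use assms in simp)
    show "\<forall>\<^sub>F n in sequentially.
        ln (poly v (real n)) / real n \<le> ln C / real n + real (degree v) * (ln (real n) / real n)"
      using eventually_ge_at_top[of 1]
    proof eventually_elim
      case (elim n)
      have "ln (poly v (real n)) \<le> ln (C * real n ^ degree v)"
        using upper[OF elim] assms[OF elim] by simp
      also have "\<dots> = ln C + real (degree v) * ln (real n)"
        using elim \<open>1 \<le> C\<close> by (simp add: ln_mult_pos ln_realpow)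
      finally have "ln (poly v (real n)) / real n \<le> (ln C + real (degree v) * ln (real n)) / real n"
        by (rule divide_right_mono) simp
      then show ?case by (simp add: add_divide_distrib)
    qed
  qed
qed

section \<open>Renyi divergence of order below one\<close>

lemma elog_ereal:
  "1 < b \<Longrightarrow> elog b (ereal x) = (if x \<le> 0 then -\<infinity> else ereal (ln x / ln b))"
  by (simp add: elog_def log_def)

lemma elog_mono:
  assumes "1 < b" "x \<le> y"
  shows "elog b (ereal x) \<le> elog b (ereal y)"
  using assms by (auto simp: elog_ereal divide_right_mono)

lemma renyi_sum_eq_affinity: "s < 1 \<Longrightarrow> renyi_sum s P Q = ereal (affinity s P Q)"
  by (simp add: renyi_sum_def affinity_def)

lemma renyi_div_eq_ln_affinity:
  assumes "1 < b" "s < 1"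
  shows "renyi_div b s P Q =
    (if affinity s P Q \<le> 0 then \<infinity> else ereal (ln (affinity s P Q) / (ln b * (s - 1))))"
  using assms by (simp add: renyi_div_def renyi_sum_eq_affinity elog_ereal mult.commute)

text \<open>The factor \<open>1 / (s - 1)\<close> is negative, so a smaller divergence means a
  larger affinity, and a vanishing affinity means divergence \<infinity>. Minimizing the divergence
  becomes maximizing the affinity.\<close>

lemma renyi_div_le_iff:
  assumes "1 < b" "s < 1" "0 < affinity s P Q"
  shows "renyi_div b s P Q \<le> renyi_div b s P' Q' \<longleftrightarrow> affinity s P' Q' \<le> affinity s P Q"
proof (cases "affinity s P' Q' \<le> 0")
  case False
  have "ln b * (s - 1) < 0"
    using assms by (simp add: mult_pos_neg)
  then show ?thesis
    using assms False by (simp add: renyi_div_eq_ln_affinity divide_le_cancel)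
qed (use assms in \<open>simp add: renyi_div_eq_ln_affinity\<close>)

section \<open>Error exponents of product distributions\<close>

lemma powr_minus_rate: "0 < b \<Longrightarrow> b powr (- (real n * R)) = exp (- (real n * (R * ln b)))"
  by (simp add: powr_def)

text \<open>The change of measure is to \<open>w\<close> proportional to \<open>P\<^sup>s Q\<^bsup>1-s\<^esup>\<close>, whose divergences from
  \<open>Q\<close> and \<open>P\<close> are \<open>s \<psi>' - \<psi>\<close> and \<open>(s - 1) \<psi>' - \<psi>\<close> for \<open>\<psi> = ln (affinity s P Q)\<close>.\<close>

lemma type1_error_lower_bound_tilted:
  fixes P Q :: "'x::finite pmf"
  assumes pos: "0 < affinity s P Q"
    and rate: "s * affinity_slope s P Q - ln (affinity s P Q) < r" and "0 < \<epsilon>"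
  shows "\<forall>\<^sub>F n in sequentially. \<forall>T\<in>tests.
      (\<Sum>xs\<in>words n. pmf (replicate_pmf n Q) xs * T xs) \<le> exp (- (real n * r)) \<longrightarrow>
      exp (- (real n * ((s - 1) * affinity_slope s P Q - ln (affinity s P Q) + \<epsilon>))) / 2
        \<le> type1_error n (replicate_pmf n P) T"
proof -
  define W where "W = affinity s P Q"
  define w where "w = (\<lambda>x. pmf P x powr s * pmf Q x powr (1 - s) / W)"
  have "0 < W" using pos by (simp add: W_def)
  have supp: "0 < pmf P x \<and> 0 < pmf Q x" if "0 < w x" for x
    using that pmf_nonneg[of P x] pmf_nonneg[of Q x] by (auto simp: w_def less_le)
  have nonneg: "0 \<le> w x" for x
    using \<open>0 < W\<close> by (simp add: w_def)
  have restrict: "(\<Sum>x\<in>UNIV. w x * f x) = (\<Sum>x | pmf P x > 0. w x * f x)" for f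
    using pmf_nonneg[of P] by (intro sum.mono_neutral_right) (auto simp: w_def less_le)
  have sum_w: "(\<Sum>x\<in>UNIV. w x) = 1"
    using restrict[of "\<lambda>_. 1"] \<open>0 < W\<close>
    by (simp add: w_def affinity_def W_def flip: sum_divide_distrib)
  have mean: "(\<Sum>x\<in>UNIV. w x * (ln (pmf P x) - ln (pmf Q x))) = affinity_slope s P Q"
    unfolding restrict by (simp add: w_def affinity_slope_def W_def flip: sum_divide_distrib)
  have ln_w: "ln (w x) = s * ln (pmf P x) + (1 - s) * ln (pmf Q x) - ln W" if "0 < w x" for x
    using supp[OF that] \<open>0 < W\<close> by (simp add: w_def ln_div ln_mult_pos)
  \<comment> \<open>On the support of \<open>w\<close>, \<open>ln (w x) - g x\<close> is affine in
    the log-likelihood ratio of \<open>P\<close> to \<open>Q\<close>. The slope \<open>c\<close> is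
    \<open>s\<close> for the divergence from \<open>Q\<close> and \<open>s - 1\<close> for that from
    \<open>P\<close>.\<close>
  have div: "(\<Sum>x\<in>UNIV. w x * (ln (w x) - g x)) = c * affinity_slope s P Q - ln W"
    if g: "\<And>x. ln (pmf P x) * s + (1 - s) * ln (pmf Q x) - g x = c * (ln (pmf P x) - ln (pmf Q x))" for g c
  proof -
    have "w x * (ln (w x) - g x) = c * (w x * (ln (pmf P x) - ln (pmf Q x))) - ln W * w x" for x
    proof (cases "w x = 0")
      case False
      then have "ln (w x) - g x = c * (ln (pmf P x) - ln (pmf Q x)) - ln W"
        using g[of x] ln_w[of x] nonneg[of x] by (simp add: less_le mult.commute)
      then show ?thesis by (simp add: right_diff_distrib mult.commute mult.left_commute)
    qed simp
    then show ?thesis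
      by (simp add: sum_subtractf mean sum_w flip: sum_distrib_left)
  qed
  have dQ: "(\<Sum>x\<in>UNIV. w x * (ln (w x) - ln (pmf Q x))) = s * affinity_slope s P Q - ln W"
    by (rule div) (simp add: algebra_simps)
  have dP: "(\<Sum>x\<in>UNIV. w x * (ln (w x) - ln (pmf P x))) = (s - 1) * affinity_slope s P Q - ln W"
    by (rule div) (simp add: algebra_simps)
  show ?thesis
    using type1_error_lower_bound[of w P Q r \<epsilon>, OF sum_w nonneg supp _ \<open>0 < \<epsilon>\<close>] rate
    unfolding dQ dP by (simp add: W_def)
qed

text \<open>The optimal test also meets the type 2 constraint against the single product
  distribution of \<open>Q\<close>, so the tilted bound applies to it. The slack
  \<open>\<epsilon>\<close> is removed at the end.\<close>

lemma error_exponent_upper_bound: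
  fixes P Q :: "'x::finite pmf"
  assumes b: "1 < b" and Q: "\<And>n. 1 \<le> n \<Longrightarrow> replicate_pmf n Q \<in> Qn n"
    and pos: "0 < affinity s P Q"
    and rate: "s * affinity_slope s P Q - ln (affinity s P Q) < R * ln b"
  shows "error_exponent b R P Qn
    \<le> ereal (((s - 1) * affinity_slope s P Q - ln (affinity s P Q)) / ln b)"
proof (rule ereal_le_epsilon2)
  fix \<epsilon> :: real assume "0 < \<epsilon>"
  define M where "M = (s - 1) * affinity_slope s P Q - ln (affinity s P Q)"
  have L: "0 < ln b" using b by simp
  \<comment> \<open>The last term comes from the factor one half in the change of measure.\<close>
  define Y where "Y = (\<lambda>n. ereal (M / ln b + \<epsilon> + ln 2 / ln b / real n))"
  have "(\<lambda>n. M / ln b + \<epsilon> + ln 2 / ln b / real n) \<longlonglongrightarrow> M / ln b + \<epsilon> + 0"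
    by (intro tendsto_add tendsto_const lim_const_over_n)
  then have Y: "Y \<longlonglongrightarrow> ereal (M / ln b + \<epsilon>)"
    by (simp add: Y_def)
  \<comment> \<open>The exponent is measured in base \<open>b\<close>, the change of measure in
    natural units.\<close>
  have "0 < \<epsilon> * ln b" using \<open>0 < \<epsilon>\<close> L by simp
  from type1_error_lower_bound_tilted[OF pos rate this]
  have "\<forall>\<^sub>F n in sequentially. ereal (- (1 / real n)) * elog b (ereal (optimal_type1_error n
      (b powr (- (real n * R))) (replicate_pmf n P) (Qn n))) \<le> Y n"
    using eventually_ge_at_top[of 1]
  proof eventually_elim
    case (elim n)
    let ?\<mu> = "b powr (- (real n * R))"
    let ?\<alpha> = "optimal_type1_error n ?\<mu> (replicate_pmf n P) (Qn n)"
    define B where "B = exp (- (real n * (M + \<epsilon> * ln b))) / 2"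
    have "0 \<le> ?\<mu>" by simp
    then obtain T where T: "T \<in> tests" "type2_error n (Qn n) T \<le> ereal ?\<mu>"
        "type1_error n (replicate_pmf n P) T = ?\<alpha>"
      by (rule optimal_type1_error_attained)
    have "(\<Sum>xs\<in>words n. pmf (replicate_pmf n Q) xs * T xs) \<le> ?\<mu>"
      using T(2) Q[OF elim(2)] by (auto simp: type2_error_def SUP_le_iff)
    then have "(\<Sum>xs\<in>words n. pmf (replicate_pmf n Q) xs * T xs) \<le> exp (- (real n * (R * ln b)))"
      using b by (simp add: powr_minus_rate)
    then have "B \<le> ?\<alpha>"
      using elim(1) T(1,3) by (auto simp: B_def M_def)
    then have "ereal (1 / real n) * elog b (ereal B) \<le> ereal (1 / real n) * elog b (ereal ?\<alpha>)"
      using b by (intro ereal_mult_left_mono elog_mono) auto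
    then have "- (ereal (1 / real n) * elog b (ereal ?\<alpha>)) \<le> - (ereal (1 / real n) * elog b (ereal B))"
      by simp
    also have "\<dots> = ereal (- (ln B / ln b / real n))"
      using b by (simp add: elog_ereal B_def)
    also have "\<dots> = Y n"
    proof -
      have "ln B = - (real n * (M + \<epsilon> * ln b)) - ln 2"
        by (simp add: B_def ln_div)
      then show ?thesis
        using L elim(2) by (simp add: Y_def field_simps)
    qed
    finally show ?case
      by (simp flip: uminus_ereal.simps(1))
  qed
  then have "error_exponent b R P Qn \<le> liminf Y"
    unfolding error_exponent_def by (rule Liminf_mono)
  also have "liminf Y = ereal (M / ln b + \<epsilon>)"
    using Y by (intro lim_imp_Liminf) auto
  finally show "error_exponent b R P Qn \<le> ereal (((s - 1) * affinity_slope s P Q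
      - ln (affinity s P Q)) / ln b) + ereal \<epsilon>"
    by (simp add: M_def)
qed

text \<open>The bound for a single \<open>n\<close> is used with \<open>g = exp (n \<psi>)\<close>
  and \<open>\<mu> = b^(-n R)\<close>. Since \<open>(1 - s)/s + 1 = 1/s\<close>, the two occurrences
  of \<open>\<psi>\<close> combine into \<open>(1 - s)/s\<close> times the Renyi term
  \<open>\<psi> / (ln b * (s - 1))\<close>.\<close>

lemma error_exponent_lower_bound:
  fixes P :: "'x::finite pmf" and U :: "nat \<Rightarrow> 'x list pmf"
  assumes b: "1 < b" and Qn: "\<And>n. 1 \<le> n \<Longrightarrow> Qn n \<subseteq> word_pmfs n"
    and U: "\<And>n. 1 \<le> n \<Longrightarrow> U n \<in> sym_pmfs n"
    and sym: "\<And>n q. 1 \<le> n \<Longrightarrow> q \<in> Qn n \<Longrightarrow> symmetrize_pmf n q \<in> Qn n \<inter> sym_pmfs n"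
    and dom: "\<And>n q xs. 1 \<le> n \<Longrightarrow> q \<in> Qn n \<inter> sym_pmfs n \<Longrightarrow> xs \<in> words n
      \<Longrightarrow> pmf q xs \<le> poly v (real n) * pmf (U n) xs"
    and v: "\<And>n. 1 \<le> n \<Longrightarrow> 1 \<le> poly v (real n)"
    and s: "0 < s" "s < 1"
    and aff: "\<And>n. 1 \<le> n \<Longrightarrow> affinity s (replicate_pmf n P) (U n) \<le> exp (real n * \<psi>)"
  shows "ereal ((1 - s) / s * (\<psi> / (ln b * (s - 1)) - R)) \<le> error_exponent b R P Qn"
proof -
  define \<kappa> where "\<kappa> = (1 - s) / s"
  have L: "0 < ln b" using b by simp
  define Y where "Y = (\<lambda>n. ereal (- (\<kappa> * (ln (poly v (real n)) / real n + \<psi> + R * ln b) + \<psi>) / ln b))"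
  have "(\<lambda>n. - (\<kappa> * (ln (poly v (real n)) / real n + \<psi> + R * ln b) + \<psi>) / ln b)
      \<longlonglongrightarrow> - (\<kappa> * (0 + \<psi> + R * ln b) + \<psi>) / ln b"
    using L by (intro tendsto_intros ln_poly_over_n_tendsto_0 v) auto
  also have "- (\<kappa> * (0 + \<psi> + R * ln b) + \<psi>) / ln b = (1 - s) / s * (\<psi> / (ln b * (s - 1)) - R)"
    using s L by (simp add: \<kappa>_def divide_simps) (simp add: algebra_simps)
  finally have Y: "Y \<longlonglongrightarrow> ereal ((1 - s) / s * (\<psi> / (ln b * (s - 1)) - R))"
    by (simp add: Y_def)
  have "\<forall>\<^sub>F n in sequentially. Y n \<le> ereal (- (1 / real n)) * elog b (ereal (optimal_type1_error n
      (b powr (- (real n * R))) (replicate_pmf n P) (Qn n)))"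
    using eventually_ge_at_top[of 1]
  proof eventually_elim
    case (elim n)
    let ?\<mu> = "b powr (- (real n * R))"
    let ?\<alpha> = "optimal_type1_error n ?\<mu> (replicate_pmf n P) (Qn n)"
    define B where "B = (poly v (real n) * exp (real n * \<psi>) / ?\<mu>) powr \<kappa> * exp (real n * \<psi>)"
    have pos: "0 < poly v (real n)" "0 < ?\<mu>"
      using v[OF elim] b by simp_all
    have "?\<alpha> \<le> B"
      unfolding B_def \<kappa>_def using pos
      by (intro optimal_type1_error_upper_bound[OF replicate_pmf_in_sym_pmfs U[OF elim] Qn[OF elim]
            sym[OF elim] dom[OF elim] s _ _ _ aff[OF elim]]) auto
    then have "ereal (1 / real n) * elog b (ereal ?\<alpha>) \<le> ereal (1 / real n) * elog b (ereal B)"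
      using b by (intro ereal_mult_left_mono elog_mono) auto
    then have "- (ereal (1 / real n) * elog b (ereal B)) \<le> - (ereal (1 / real n) * elog b (ereal ?\<alpha>))"
      by simp
    moreover have "- (ereal (1 / real n) * elog b (ereal B)) = Y n"
    proof -
      have "0 < B" using pos by (simp add: B_def)
      have "ln B = \<kappa> * (ln (poly v (real n)) + real n * \<psi> + real n * R * ln b) + real n * \<psi>"
        using pos by (simp add: B_def ln_mult_pos ln_div powr_minus_rate ln_powr)
      then have "- (ln B / ln b / real n) = - (\<kappa> * (ln (poly v (real n)) / real n + \<psi> + R * ln b) + \<psi>) / ln b"
        using elim L by (simp add: field_simps)
      then show ?thesis
        using b \<open>0 < B\<close> by (simp add: elog_ereal Y_def mult.commute)
    qed
    ultimately show ?case
      by (simp flip: uminus_ereal.simps(1))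
  qed
  then have "liminf Y \<le> error_exponent b R P Qn"
    unfolding error_exponent_def by (rule Liminf_mono)
  moreover have "liminf Y = ereal ((1 - s) / s * (\<psi> / (ln b * (s - 1)) - R))"
    using Y by (intro lim_imp_Liminf) auto
  ultimately show ?thesis by simp
qed

section \<open>The optimal order\<close>

text \<open>Either \<open>N\<close> reaches \<open>r\<close> beyond \<open>s0\<close>, and a value
  just below \<open>r\<close> makes the last factor small; or it never does, and \<open>s\<close>
  can approach one, where \<open>(1 - s) / s\<close> vanishes while monotonicity keeps
  \<open>r - N s\<close> bounded.\<close>

lemma near_critical_order:
  fixes N :: "real \<Rightarrow> real"
  assumes "0 \<le> a" and N: "continuous_on {a<..<1} N"
    and mono: "\<And>s t. s \<in> {a<..<1} \<Longrightarrow> t \<in> {a<..<1} \<Longrightarrow> s \<le> t \<Longrightarrow> N s \<le> N t"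
    and s0: "s0 \<in> {a<..<1}" "N s0 < r" and "0 < \<delta>"
  obtains s where "s \<in> {a<..<1}" "N s < r" "(1 - s) / s * (r - N s) \<le> \<delta>"
proof (cases "\<exists>t\<in>{s0..<1}. r \<le> N t")
  case True
  then obtain t where t: "s0 \<le> t" "t < 1" "r \<le> N t" by auto
  \<comment> \<open>The level lies at most \<open>\<delta> * s0\<close> below \<open>r\<close>,
    which compensates \<open>(1 - s) / s \<le> 1 / s0\<close>; the maximum keeps it within reach of
    the intermediate value theorem.\<close>
  define y where "y = max (N s0) (r - \<delta> * s0)"
  have "0 < s0" using assms by auto
  then have y: "N s0 \<le> y" "y < r" "r - y \<le> \<delta> * s0"
    using s0 \<open>0 < \<delta>\<close> by (auto simp: y_def)
  have "continuous_on {s0..t} N"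
    using t s0 by (intro continuous_on_subset[OF N]) auto
  then obtain s where s: "s0 \<le> s" "s \<le> t" "N s = y"
    using IVT'[of N s0 y t] y t by auto
  have "(1 - s) / s * (r - N s) \<le> 1 / s0 * (\<delta> * s0)"
    using s t y \<open>0 < s0\<close> by (intro mult_mono frac_le) auto
  then show thesis
    using s t s0 y \<open>0 < s0\<close> by (intro that[of s]) auto
next
  case False
  define d where "d = r - N s0"
  \<comment> \<open>\<open>d / (d + \<delta>)\<close> solves
    \<open>(1 - s) / s * d = \<delta>\<close>.\<close>
  define s where "s = max s0 (d / (d + \<delta>))"
  have d: "0 < d" using s0 by (simp add: d_def)
  have s: "s0 \<le> s" "s < 1" "d / (d + \<delta>) \<le> s" "0 < s"
    using s0 \<open>0 \<le> a\<close> d \<open>0 < \<delta>\<close> by (auto simp: s_def)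
  have "s \<in> {s0..<1}"
    using s by simp
  then have "N s < r"
    using False not_le by blast
  have "r - N s \<le> d"
    unfolding d_def using mono[of s0 s] s s0 by auto
  then have "(1 - s) / s * (r - N s) \<le> (1 - s) / s * d"
    using s by (intro mult_left_mono) auto
  also have "\<dots> \<le> \<delta>"
    using s d \<open>0 < \<delta>\<close> by (simp add: field_simps)
  finally show thesis
    using s s0 \<open>N s < r\<close> by (intro that[of s]) auto
qed

section \<open>Consequences of the regular parametrization and of the critical rate\<close>

lemma C2_on_imp_continuous_on:
  assumes "C2_on S f"
  shows "continuous_on S f"
proof -
  obtain f' where "\<And>t. t \<in> S \<Longrightarrow> (f has_derivative blinfun_apply (f' t)) (at t within S)"
    using assms unfolding C2_on_def by blast
  then show ?thesis
    by (rule has_derivative_continuous_on)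
qed

lemma has_hessian_within_finite:
  assumes "has_hessian_within f H t S" "t \<in> S"
  shows "f t \<noteq> \<infinity>"
proof -
  from assms(1) obtain F F' where "\<forall>\<^sub>F u in inf (nhds t) (principal S).
      f u = ereal (F u) \<and> (F has_derivative blinfun_apply (F' u)) (at u within S)"
    unfolding has_hessian_within_def by blast
  then have "t \<in> S \<longrightarrow> f t = ereal (F t) \<and> (F has_derivative blinfun_apply (F' t)) (at t within S)"
    unfolding eventually_inf_principal by (rule eventually_nhds_x_imp_x)
  with assms(2) show ?thesis by simp
qed

text \<open>A letter charged by \<open>P\<close> but not by \<open>Q\<close> would contribute an
  infinite term. Finite divergence at order one thus puts the support of \<open>P\<close> inside
  that of \<open>Q\<close>, and every summand of the affinity is positive.\<close>

lemma renyi_div_1_finite_imp_affinity_pos: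
  fixes P Q :: "'x::finite pmf"
  assumes "1 < b" "renyi_div b 1 P Q \<noteq> \<infinity>"
  shows "0 < affinity s P Q"
proof -
  have supp: "0 < pmf Q x" if "0 < pmf P x" for x
  proof (rule ccontr)
    assume "\<not> 0 < pmf Q x"
    then have "pmf Q x = 0"
      using pmf_nonneg[of Q x] by linarith
    then have "ereal (pmf P x) * (elog b (ereal (pmf P x)) - elog b (ereal (pmf Q x))) = \<infinity>"
      using that \<open>1 < b\<close> by (simp add: elog_ereal)
    then have "renyi_div b 1 P Q = \<infinity>"
      using that by (auto simp: renyi_div_def sum_Pinfty)
    with assms show False by simp
  qed
  obtain x where "x \<in> set_pmf P"
    using set_pmf_not_empty by fast
  then have "0 < pmf P x"
    by (simp add: pmf_positive)
  then show ?thesis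
    unfolding affinity_def using supp by (intro sum_pos) fastforce+
qed

text \<open>Unique minimizers of the divergence become unique maximizers of the affinity. That the
  maximum is positive comes from the minimizer at order one: having a Hessian there, the divergence
  is finite, so this parameter has positive affinity at every order.\<close>

lemma regular_parametrization_argmax:
  fixes P :: "'x::finite pmf"
  assumes b: "1 < b" and a: "a < 1"
    and reg: "regular_parametrization b {a<..1} P Qn \<Theta> Qt"
  obtains \<theta> where "\<And>s. s \<in> {a<..<1} \<Longrightarrow> \<theta> s \<in> \<Theta>"
    and "\<And>s. s \<in> {a<..<1} \<Longrightarrow> 0 < affinity s P (Qt (\<theta> s))"
    and "\<And>s t. s \<in> {a<..<1} \<Longrightarrow> t \<in> \<Theta> \<Longrightarrow> affinity s P (Qt t) \<le> affinity s P (Qt (\<theta> s))"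
    and "\<And>s t. s \<in> {a<..<1} \<Longrightarrow> t \<in> \<Theta> \<Longrightarrow> affinity s P (Qt t) = affinity s P (Qt (\<theta> s)) \<Longrightarrow> t = \<theta> s"
proof -
  define M where "M = (\<lambda>s. is_arg_min (\<lambda>t. renyi_div b s P (Qt t)) (\<lambda>t. t \<in> \<Theta>))"
  have ex1: "\<exists>!t. M s t" if "s \<in> {a<..1}" for s
    using reg that by (auto simp: regular_parametrization_def M_def)
  define \<theta> where "\<theta> = (\<lambda>s. THE t. M s t)"
  have M: "M s (\<theta> s)" if "s \<in> {a<..1}" for s
    unfolding \<theta>_def by (rule theI'[OF ex1[OF that]])
  have M_iff: "M s t \<longleftrightarrow> t \<in> \<Theta> \<and> (\<forall>u\<in>\<Theta>. renyi_div b s P (Qt t) \<le> renyi_div b s P (Qt u))" for s t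
    by (auto simp: M_def is_arg_min_linorder)
  have \<theta>: "\<theta> s \<in> \<Theta>" if "s \<in> {a<..1}" for s
    using M[OF that] by (simp add: M_iff)
  have "1 \<in> {a<..1}" using a by simp
  then have "pos_def_hessian (\<lambda>t. renyi_div b 1 P (Qt t)) (\<theta> 1) \<Theta>"
    using reg M[of 1] unfolding regular_parametrization_def M_def by blast
  then have "renyi_div b 1 P (Qt (\<theta> 1)) \<noteq> \<infinity>"
    using has_hessian_within_finite \<theta>[OF \<open>1 \<in> {a<..1}\<close>] by (fastforce simp: pos_def_hessian_def)
  then have pos1: "0 < affinity s P (Qt (\<theta> 1))" for s
    by (rule renyi_div_1_finite_imp_affinity_pos[OF b])
  show thesis
  proof (rule that[of \<theta>])
    fix s assume "s \<in> {a<..<1}"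
    then have s: "s \<in> {a<..1}" "s < 1" by simp_all
    show "\<theta> s \<in> \<Theta>" using \<theta> s by blast
    have min: "renyi_div b s P (Qt (\<theta> s)) \<le> renyi_div b s P (Qt u)" if "u \<in> \<Theta>" for u
      using M[OF s(1)] that by (simp add: M_iff)
    show pos: "0 < affinity s P (Qt (\<theta> s))"
      using min[OF \<theta>[OF \<open>1 \<in> {a<..1}\<close>]] pos1[of s] b s(2)
      by (auto simp: renyi_div_eq_ln_affinity split: if_splits)
    fix t assume t: "t \<in> \<Theta>"
    show "affinity s P (Qt t) \<le> affinity s P (Qt (\<theta> s))"
      using min[OF t] renyi_div_le_iff[where P = P and P' = P, OF b s(2) pos] by blast
    assume "affinity s P (Qt t) = affinity s P (Qt (\<theta> s))"
    then have "renyi_div b s P (Qt t) = renyi_div b s P (Qt (\<theta> s))"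
      using b s(2) by (simp add: renyi_div_eq_ln_affinity)
    then have "M s t"
      using min t by (simp add: M_iff)
    then show "t = \<theta> s"
      using M[OF s(1)] ex1[OF s(1)] by blast
  qed
qed

text \<open>By monotonicity the right limit at \<open>a\<close> exists and equals the infimum over
  the interval, so a rate above the limit exceeds \<open>N\<close> at some order.\<close>

lemma critical_rate_lessD:
  assumes "a < 1" and N: "\<And>s. s \<in> {a<..<1} \<Longrightarrow> s * deriv (phi b P QQ) s - phi b P QQ s = N s"
    and mono: "\<And>s t. s \<in> {a<..<1} \<Longrightarrow> t \<in> {a<..<1} \<Longrightarrow> s \<le> t \<Longrightarrow> N s \<le> N t"
    and "critical_rate b a P QQ < ereal R"
  obtains s where "s \<in> {a<..<1}" "N s < R"
proof -
  let ?F = "\<lambda>s. ereal (s * deriv (phi b P QQ) s - phi b P QQ s)"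
  let ?I = "{a<..} \<inter> {..<1}"
  have I: "?I = {a<..<1}" by auto
  have "(?F \<longlongrightarrow> Inf (?F ` ?I)) (at a within ?I)"
    by (rule Lim_right_bound[where K = "-\<infinity>"]) (use N mono in auto)
  moreover have "at a within ?I = at_right a"
    using \<open>a < 1\<close> by (intro at_within_nhd[of a "{..<1}"]) auto
  ultimately have "critical_rate b a P QQ = Inf (?F ` ?I)"
    unfolding critical_rate_def by (intro tendsto_Lim) auto
  then obtain s where "s \<in> {a<..<1}" "?F s < ereal R"
    using assms(4) I by (auto simp: INF_less_iff)
  then show thesis using that N by auto
qed

section \<open>Matching the two bounds on the exponent\<close>

theorem theorem9:
  fixes b a R :: real
    and P :: "'x::finite pmf"
    and Qn :: "nat \<Rightarrow> 'x list pmf set"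
    and \<Theta> :: "'v::euclidean_space set"
    and Qt :: "'v \<Rightarrow> 'x pmf"
  assumes "1 < b"
    and "0 \<le> a" "a < 1"
    and "\<And>n. 1 \<le> n \<Longrightarrow> Qn n \<subseteq> word_pmfs n"
    and "contains_products Qn"
    and "renyi_superadditive b {a<..1} P Qn"
    and "has_universal_pmf b {a<..1} P Qn"
    and "regular_parametrization b {a<..1} P Qn \<Theta> Qt"
    and "critical_rate b a P (letter_set Qn) < ereal R"
  shows "error_exponent b R P Qn =
    (SUP s\<in>{a<..<1}. ereal ((1 - s) / s) * (renyi_div_set b s P (letter_set Qn) - ereal R))"
proof -
  let ?J = "{a<..<1}"
  have L: "0 < ln b" using \<open>1 < b\<close> by simp
  have "compact \<Theta>" and letters: "letter_set Qn = Qt ` \<Theta>"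
    and Qt: "\<And>x. continuous_on \<Theta> (\<lambda>t. pmf (Qt t) x)"
    using assms(8) by (auto simp: regular_parametrization_def intro: C2_on_imp_continuous_on)
  obtain \<theta> where \<theta>: "\<And>s. s \<in> ?J \<Longrightarrow> \<theta> s \<in> \<Theta>"
    and pos: "\<And>s. s \<in> ?J \<Longrightarrow> 0 < affinity s P (Qt (\<theta> s))"
    and max: "\<And>s t. s \<in> ?J \<Longrightarrow> t \<in> \<Theta> \<Longrightarrow> affinity s P (Qt t) \<le> affinity s P (Qt (\<theta> s))"
    and uniq: "\<And>s t. s \<in> ?J \<Longrightarrow> t \<in> \<Theta> \<Longrightarrow> affinity s P (Qt t) = affinity s P (Qt (\<theta> s)) \<Longrightarrow> t = \<theta> s"
    using regular_parametrization_argmax[OF assms(1,3,8)] by blast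
  define \<psi> where "\<psi> = (\<lambda>s. ln (affinity s P (Qt (\<theta> s))))"
  define h where "h = (\<lambda>s. affinity_slope s P (Qt (\<theta> s)))"
  have D: "renyi_div_set b s P (letter_set Qn) = ereal (\<psi> s / (ln b * (s - 1)))" if s: "s \<in> ?J" for s
  proof -
    have "renyi_div_set b s P (letter_set Qn) = renyi_div b s P (Qt (\<theta> s))"
      unfolding renyi_div_set_def letters
      using \<theta>[OF s] max[OF s] pos[OF s] s \<open>1 < b\<close>
      by (intro antisym INF_lower2[of "Qt (\<theta> s)"] INF_greatest) (auto simp: renyi_div_le_iff)
    then show ?thesis
      using pos[OF s] s \<open>1 < b\<close> by (simp add: renyi_div_eq_ln_affinity \<psi>_def)
  qed
  have phi: "phi b P (letter_set Qn) s = \<psi> s / ln b" if "s \<in> ?J" for s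
    using that L by (simp add: phi_def D)

  have cont: "continuous_on ?J \<theta>"
  proof (rule continuous_on_argmax[where g = "\<lambda>s t. affinity s P (Qt t)", OF \<open>compact \<Theta>\<close> _ \<theta> max uniq])
    show "continuous_on (?J \<times> \<Theta>) (\<lambda>z. affinity (fst z) P (Qt (snd z)))"
      by (intro continuous_on_affinity continuous_on_compose2[OF Qt] continuous_on_fst continuous_on_snd
          continuous_on_id) auto
  qed
  have h_cont: "continuous_on ?J h"
    unfolding h_def using \<theta> pos
    by (intro continuous_on_affinity_slope continuous_on_compose2[OF Qt cont] continuous_on_id) auto
  \<comment> \<open>With the parameter frozen at \<open>\<theta> s\<close> the tangent bound holds
    at \<open>t\<close>, and maximizing over the parameter only raises the right-hand side; so
    \<open>h\<close> is a subgradient of \<open>\<psi>\<close>.\<close>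
  have sub: "\<psi> s + h s * (t - s) \<le> \<psi> t" if "s \<in> ?J" "t \<in> ?J" for s t
  proof -
    have "\<psi> s + h s * (t - s) \<le> ln (affinity t P (Qt (\<theta> s)))"
      unfolding \<psi>_def h_def by (rule ln_affinity_tangent(2)[OF pos[OF that(1)]])
    also have "\<dots> \<le> \<psi> t"
      unfolding \<psi>_def using max[OF that(2) \<theta>[OF that(1)]] ln_affinity_tangent(1)[OF pos[OF that(1)]]
        pos[OF that(2)] by (intro ln_mono) auto
    finally show ?thesis .
  qed
  \<comment> \<open>This is \<open>ln b\<close> times the function whose right limit at
    \<open>a\<close> is the critical rate.\<close>
  define N where "N = (\<lambda>s. s * h s - \<psi> s)"
  have deriv: "(\<psi> has_real_derivative h s) (at s)" if "s \<in> ?J" for s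
    by (rule DERIV_of_subgradients[OF _ that sub h_cont]) auto
  then have "continuous_on ?J \<psi>"
    by (intro DERIV_continuous_on) (blast intro: has_field_derivative_at_within)
  then have N_cont: "continuous_on ?J N"
    unfolding N_def by (intro continuous_on_diff continuous_on_mult continuous_on_id h_cont)
  have N_mono: "N s \<le> N t" if "s \<in> ?J" "t \<in> ?J" "s \<le> t" for s t
    unfolding N_def using that \<open>0 \<le> a\<close> by (intro legendre_slope_mono[where S = ?J, OF sub]) auto
  have phi_deriv: "deriv (phi b P (letter_set Qn)) s = h s / ln b" if "s \<in> ?J" for s
  proof (rule DERIV_imp_deriv)
    have "((\<lambda>s. \<psi> s / ln b) has_real_derivative h s / ln b) (at s)"
      by (rule DERIV_cdivide[OF deriv[OF that]])
    then show "(phi b P (letter_set Qn) has_real_derivative h s / ln b) (at s)"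
      by (rule has_field_derivative_transform_within_open[of _ _ _ ?J]) (use that phi in auto)
  qed
  obtain s0 where "s0 \<in> ?J" "N s0 / ln b < R"
  proof (rule critical_rate_lessD[OF \<open>a < 1\<close> _ _ assms(9), of "\<lambda>s. N s / ln b"])
    show "s * deriv (phi b P (letter_set Qn)) s - phi b P (letter_set Qn) s = N s / ln b" if "s \<in> ?J" for s
      by (simp add: phi[OF that] phi_deriv[OF that] N_def diff_divide_distrib)
  qed (use N_mono L in \<open>auto simp: divide_right_mono\<close>)
  then have s0: "N s0 < R * ln b"
    using L by (simp add: field_simps)

  have products: "replicate_pmf n (Qt t) \<in> Qn n" if "t \<in> \<Theta>" "1 \<le> n" for t n
    using assms(5) that by (auto simp: contains_products_def letters)
  define f where "f = (\<lambda>s. (1 - s) / s * (\<psi> s / (ln b * (s - 1)) - R))"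
  have f: "ereal ((1 - s) / s) * (renyi_div_set b s P (letter_set Qn) - ereal R) = ereal (f s)"
    if "s \<in> ?J" for s
    using that by (simp add: D f_def)

  have "error_exponent b R P Qn \<le> (SUP s\<in>?J. ereal (f s))"
  proof (rule ereal_le_epsilon2)
    fix \<epsilon> :: real assume "0 < \<epsilon>"
    then have "0 < \<epsilon> * ln b" using L by simp
    then obtain s where s: "s \<in> ?J" "N s < R * ln b" "(1 - s) / s * (R * ln b - N s) \<le> \<epsilon> * ln b"
      using near_critical_order[OF \<open>0 \<le> a\<close> N_cont _ \<open>s0 \<in> ?J\<close> s0] N_mono by blast
    have "0 < s" "s < 1" using s(1) \<open>0 \<le> a\<close> by auto
    have "error_exponent b R P Qn \<le> ereal (((s - 1) * h s - \<psi> s) / ln b)"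
      unfolding h_def \<psi>_def
      using s by (intro error_exponent_upper_bound \<open>1 < b\<close> products \<theta> pos) (auto simp: N_def h_def \<psi>_def)
    \<comment> \<open>The excess over \<open>f s\<close> is what the choice of \<open>s\<close>
      keeps at most \<open>\<epsilon>\<close>.\<close>
    also have "((s - 1) * h s - \<psi> s) / ln b = f s + (1 - s) / s * (R * ln b - N s) / ln b"
      using \<open>0 < s\<close> \<open>s < 1\<close> L by (simp add: f_def N_def divide_simps) (simp add: algebra_simps)
    also have "ereal \<dots> \<le> ereal (f s) + ereal \<epsilon>"
      using divide_right_mono[OF s(3), of "ln b"] L by simp
    also have "\<dots> \<le> (SUP s\<in>?J. ereal (f s)) + ereal \<epsilon>"
      using s(1) by (intro add_right_mono SUP_upper)
    finally show "error_exponent b R P Qn \<le> (SUP s\<in>?J. ereal (f s)) + ereal \<epsilon>" .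
  qed
  moreover have "(SUP s\<in>?J. ereal (f s)) \<le> error_exponent b R P Qn"
  proof (rule SUP_least)
    fix s assume s: "s \<in> ?J"
    then have "0 < s" "s < 1" using \<open>0 \<le> a\<close> by auto
    obtain U v where U: "\<And>n. 1 \<le> n \<Longrightarrow> U n \<in> sym_pmfs n"
      and dom: "\<And>n q xs. 1 \<le> n \<Longrightarrow> q \<in> Qn n \<inter> sym_pmfs n \<Longrightarrow> xs \<in> words n
        \<Longrightarrow> pmf q xs \<le> poly v (real n) * pmf (U n) xs"
      and div: "\<And>n s. 1 \<le> n \<Longrightarrow> s \<in> {a<..1} \<Longrightarrow>
        renyi_div_set b s (replicate_pmf n P) (Qn n) \<le> renyi_div b s (replicate_pmf n P) (U n)"
      and sym: "\<And>n q. 1 \<le> n \<Longrightarrow> q \<in> Qn n \<Longrightarrow> symmetrize_pmf n q \<in> Qn n \<inter> sym_pmfs n"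
      using assms(7) unfolding has_universal_pmf_def by blast
    \<comment> \<open>Domination of one product distribution, summed over all words, compares two
      total masses equal to one.\<close>
    have v: "1 \<le> poly v (real n)" if n: "1 \<le> n" for n
    proof -
      let ?q = "replicate_pmf n (Qt (\<theta> s))"
      have q: "?q \<in> Qn n \<inter> sym_pmfs n"
        using products[OF \<theta>[OF s] n] replicate_pmf_in_sym_pmfs by blast
      have "1 = (\<Sum>xs\<in>words n. pmf ?q xs)"
        using q by (intro sum_words_pmf[symmetric]) (simp add: sym_pmfs_def)
      also have "\<dots> \<le> (\<Sum>xs\<in>words n. poly v (real n) * pmf (U n) xs)"
        by (intro sum_mono dom[OF n q])
      also have "\<dots> = poly v (real n)"
        using U[OF n] by (simp add: sum_words_pmf sym_pmfs_def flip: sum_distrib_left)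
      finally show ?thesis .
    qed
    \<comment> \<open>Axioms 3 and 4 together bound the divergence from \<open>U n\<close> below by
      \<open>n\<close> times the single-letter value. The negative factor
      \<open>ln b * (s - 1)\<close> turns this into an upper bound on the affinity.\<close>
    have aff: "affinity s (replicate_pmf n P) (U n) \<le> exp (real n * \<psi> s)" if n: "1 \<le> n" for n
    proof (cases "affinity s (replicate_pmf n P) (U n) \<le> 0")
      case False
      let ?A = "affinity s (replicate_pmf n P) (U n)"
      have "s \<in> {a<..1}" using s by simp
      then have "ereal (real n) * renyi_div_set b s P (letter_set Qn)
          \<le> renyi_div_set b s (replicate_pmf n P) (Qn n)"
        using assms(6) n unfolding renyi_superadditive_def by blast
      also have "\<dots> \<le> renyi_div b s (replicate_pmf n P) (U n)"
        by (rule div[OF n \<open>s \<in> {a<..1}\<close>])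
      finally have "ereal (real n) * renyi_div_set b s P (letter_set Qn)
          \<le> renyi_div b s (replicate_pmf n P) (U n)" .
      then have "real n * \<psi> s / (ln b * (s - 1)) \<le> ln ?A / (ln b * (s - 1))"
        using False \<open>s < 1\<close> \<open>1 < b\<close> by (simp add: D[OF s] renyi_div_eq_ln_affinity)
      moreover have "ln b * (s - 1) < 0"
        using L \<open>s < 1\<close> by (simp add: mult_pos_neg)
      ultimately have "ln ?A \<le> real n * \<psi> s"
        by (simp add: divide_le_cancel)
      then show ?thesis
        using False by (subst ln_le_cancel_iff[symmetric]) simp_all
    qed (erule order_trans, simp)
    show "ereal (f s) \<le> error_exponent b R P Qn"
      unfolding f_def
      by (rule error_exponent_lower_bound[OF \<open>1 < b\<close> assms(4) U sym dom v \<open>0 < s\<close> \<open>s < 1\<close> aff])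
  qed
  ultimately have "error_exponent b R P Qn = (SUP s\<in>?J. ereal (f s))"
    by (rule antisym)
  also have "\<dots> = (SUP s\<in>?J. ereal ((1 - s) / s) * (renyi_div_set b s P (letter_set Qn) - ereal R))"
    by (intro SUP_cong refl) (simp only: f)
  finally show ?thesis .
qed

end
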